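(* Let $\Omega\subset\mathbb{C}^2$ be a smoothly bounded, pseudoconvex domain, and let $p_0\in b\Omega$ be a point of weak pseudoconvexity for $\Omega$. If $p_0$ is of strict type $4$, then $\Omega$ admits a smooth local defining function near $p_0$ which is plurisubharmonic on $b\Omega$ near $p_0$.
   Context: "Smooth" means $\mathcal{C}^\infty$; "smoothly bounded" means that $b\Omega$ is smooth. A smooth function $r\colon U\to\mathbb{R}$ is a local defining function for $\Omega$ near $p_0\in b\Omega$ if $U$ is an open neighborhood of $p_0$, $\Omega\cap U=\{r<0\}$, and $dr\ne0$ on $b\Omega\cap U$. A "holomorphic vector field" means a smooth vector field of type $(1,0)$; it is tangential if $Lr=0$ on $b\Omega$. For $(1,0)$ vector fields, $H_f(A,B)=\sum_{j,k}\frac{\partial^2f}{\partial z^j\partial\bar z^k}A^j\overline{B^k}$. $\Omega$ is pseudoconvex at $p\in b\Omega$ if $H_r(L,L)\ge0$ on $b\Omega$ near $p$ for all holomorphic tangential $L$; strictly pseudoconvex at $p$ if in addition the inequality is strict whenever $L$ is nonvanishing; weakly pseudoconvex at $p$ if pseudoconvex but not strictly pseudoconvex at $p$. A local defining function $r$ is plurisubharmonic on $b\Omega$ near $p_0$ if there is an open neighborhood $U$ of $p_0$ such that $H_r(V,V)\ge0$ at every point of $b\Omega\cap U$ for every smooth $(1,0)$ vector field $V$ on $U$ (all directions, but only at boundary points). Strict type $4$: for a smooth local defining function $r$ near $p_0$ and a nonvanishing holomorphic tangential vector field $L$ near $p_0$, set $\lambda:=H_r(L,L)|_{b\Omega}$.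 $p_0$ is of strict type $4$ if $\Omega$ is weakly pseudoconvex at $p_0$ and $(L\bar L\lambda)(p_0)>|(LL\lambda)(p_0)|$. This does not depend on the choices of $r$ and $L$. *)

theory Defs
  imports "HOL-Analysis.Analysis"
begin

section \<open>Smooth maps on open subsets of Euclidean spaces\<close>

text \<open>\<open>Ck_on k S f\<close> is meant for open \<open>S\<close>. Smoothness is real smoothness: spaces such as
  \<open>complex ^ 'n\<close> are regarded as real vector spaces.\<close>

primrec Ck_on ::
  "nat \<Rightarrow> 'a::euclidean_space set \<Rightarrow> ('a \<Rightarrow> 'b::euclidean_space) \<Rightarrow> bool" where
  "Ck_on 0 S f \<longleftrightarrow> continuous_on S f"
| "Ck_on (Suc k) S f \<longleftrightarrow>
     (\<forall>x\<in>S. f differentiable (at x)) \<and>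
     (\<forall>v. Ck_on k S (\<lambda>x. frechet_derivative f (at x) v))"

definition smooth_on :: "'a::euclidean_space set \<Rightarrow> ('a \<Rightarrow> 'b::euclidean_space) \<Rightarrow> bool" where
  "smooth_on S f \<longleftrightarrow> (\<forall>k. Ck_on k S f)"


section \<open>Wirtinger derivatives, vector fields of type (1,0) and the complex Hessian\<close>

definition dz :: "'n \<Rightarrow> (complex ^ 'n \<Rightarrow> complex) \<Rightarrow> complex ^ 'n \<Rightarrow> complex" where
  "dz j f p = (frechet_derivative f (at p) (axis j 1)
               - \<i> * frechet_derivative f (at p) (axis j \<i>)) / 2"

definition dzbar :: "'n \<Rightarrow> (complex ^ 'n \<Rightarrow> complex) \<Rightarrow> complex ^ 'n \<Rightarrow> complex" where
  "dzbar j f p = (frechet_derivative f (at p) (axis j 1)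
                  + \<i> * frechet_derivative f (at p) (axis j \<i>)) / 2"

text \<open>A field \<open>L = (\<Sum>j. L\<^sup>j \<partial>/\<partial>z\<^sup>j)\<close> of type (1,0) is represented by its coefficient
  vector \<open>L :: complex ^ 'n \<Rightarrow> complex ^ 'n\<close>; \<open>vf_conj_apply L\<close> is the action of its complex
  conjugate \<open>(\<Sum>j. cnj (L\<^sup>j) \<partial>/\<partial>zbar\<^sup>j)\<close>.\<close>

definition vf_apply ::
  "(complex ^ 'n \<Rightarrow> complex ^ 'n) \<Rightarrow> (complex ^ 'n \<Rightarrow> complex) \<Rightarrow> complex ^ 'n \<Rightarrow> complex" where
  "vf_apply L f p = (\<Sum>j\<in>UNIV. L p $ j * dz j f p)"

definition vf_conj_apply ::
  "(complex ^ 'n \<Rightarrow> complex ^ 'n) \<Rightarrow> (complex ^ 'n \<Rightarrow> complex) \<Rightarrow> complex ^ 'n \<Rightarrow> complex" where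
  "vf_conj_apply L f p = (\<Sum>j\<in>UNIV. cnj (L p $ j) * dzbar j f p)"

definition complex_hessian ::
  "(complex ^ 'n \<Rightarrow> real) \<Rightarrow> (complex ^ 'n \<Rightarrow> complex ^ 'n) \<Rightarrow> (complex ^ 'n \<Rightarrow> complex ^ 'n)
    \<Rightarrow> complex ^ 'n \<Rightarrow> complex" where
  "complex_hessian f A B p =
     (\<Sum>j\<in>UNIV. \<Sum>k\<in>UNIV. dz j (dzbar k (\<lambda>z. complex_of_real (f z))) p * A p $ j * cnj (B p $ k))"

text \<open>For real-valued \<open>f\<close> of class \<open>C\<^sup>2\<close> the complex Hessian is Hermitian, so \<open>H\<^sub>f(L,L)\<close> is a real
  number; \<open>Re\<close> only changes its type.\<close>

definition levi :: "(complex ^ 'n \<Rightarrow> real) \<Rightarrow> (complex ^ 'n \<Rightarrow> complex ^ 'n) \<Rightarrow> complex ^ 'n \<Rightarrow> real"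
  where "levi f L p = Re (complex_hessian f L L p)"


section \<open>Defining functions and pseudoconvexity\<close>

definition local_defining_function ::
  "(complex ^ 'n) set \<Rightarrow> complex ^ 'n \<Rightarrow> (complex ^ 'n) set \<Rightarrow> (complex ^ 'n \<Rightarrow> real) \<Rightarrow> bool" where
  "local_defining_function \<Omega> p U r \<longleftrightarrow>
     open U \<and> p \<in> U \<and> smooth_on U r \<and>
     \<Omega> \<inter> U = {z \<in> U. r z < 0} \<and>
     (\<forall>z \<in> frontier \<Omega> \<inter> U. frechet_derivative r (at z) \<noteq> (\<lambda>v. 0))"

definition smooth_boundary :: "(complex ^ 'n) set \<Rightarrow> bool" where
  "smooth_boundary \<Omega> \<longleftrightarrow> (\<forall>p \<in> frontier \<Omega>. \<exists>U r. local_defining_function \<Omega> p U r)"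

definition tangential_vf ::
  "(complex ^ 'n) set \<Rightarrow> (complex ^ 'n \<Rightarrow> real) \<Rightarrow> (complex ^ 'n) set
    \<Rightarrow> (complex ^ 'n \<Rightarrow> complex ^ 'n) \<Rightarrow> bool" where
  "tangential_vf \<Omega> r V L \<longleftrightarrow>
     smooth_on V L \<and>
     (\<forall>z \<in> frontier \<Omega> \<inter> V. vf_apply L (\<lambda>w. complex_of_real (r w)) z = 0)"

text \<open>The defining function is quantified existentially throughout, since the notions do not depend
  on its choice. The fields range over all open neighbourhoods \<open>V\<close> of \<open>p\<close> inside \<open>U\<close>: a
  nonvanishing tangential field need not exist on an arbitrary \<open>U\<close>, and quantifying over fields on
  \<open>U\<close> alone could make strict pseudoconvexity vacuous.\<close>

definition pseudoconvex_at :: "(complex ^ 'n) set \<Rightarrow> complex ^ 'n \<Rightarrow> bool" where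
  "pseudoconvex_at \<Omega> p \<longleftrightarrow>
     p \<in> frontier \<Omega> \<and>
     (\<exists>U r. local_defining_function \<Omega> p U r \<and>
        (\<forall>V L. open V \<and> p \<in> V \<and> V \<subseteq> U \<and> tangential_vf \<Omega> r V L \<longrightarrow>
           (\<forall>z \<in> frontier \<Omega> \<inter> V. 0 \<le> levi r L z)))"

definition strictly_pseudoconvex_at :: "(complex ^ 'n) set \<Rightarrow> complex ^ 'n \<Rightarrow> bool" where
  "strictly_pseudoconvex_at \<Omega> p \<longleftrightarrow>
     p \<in> frontier \<Omega> \<and>
     (\<exists>U r. local_defining_function \<Omega> p U r \<and>
        (\<forall>V L. open V \<and> p \<in> V \<and> V \<subseteq> U \<and> tangential_vf \<Omega> r V L \<longrightarrow>
           (\<forall>z \<in> frontier \<Omega> \<inter> V. 0 \<le> levi r L z) \<and>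
           ((\<forall>z \<in> V. L z \<noteq> 0) \<longrightarrow> (\<forall>z \<in> frontier \<Omega> \<inter> V. 0 < levi r L z))))"

definition weakly_pseudoconvex_at :: "(complex ^ 'n) set \<Rightarrow> complex ^ 'n \<Rightarrow> bool" where
  "weakly_pseudoconvex_at \<Omega> p \<longleftrightarrow> pseudoconvex_at \<Omega> p \<and> \<not> strictly_pseudoconvex_at \<Omega> p"

definition pseudoconvex :: "(complex ^ 'n) set \<Rightarrow> bool" where
  "pseudoconvex \<Omega> \<longleftrightarrow> (\<forall>p \<in> frontier \<Omega>. pseudoconvex_at \<Omega> p)"

definition plurisubharmonic_on_boundary_near ::
  "(complex ^ 'n) set \<Rightarrow> complex ^ 'n \<Rightarrow> (complex ^ 'n) set \<Rightarrow> (complex ^ 'n \<Rightarrow> real) \<Rightarrow> bool" where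
  "plurisubharmonic_on_boundary_near \<Omega> p U r \<longleftrightarrow>
     (\<exists>W. open W \<and> p \<in> W \<and> W \<subseteq> U \<and>
        (\<forall>V. smooth_on W V \<longrightarrow> (\<forall>z \<in> frontier \<Omega> \<inter> W. 0 \<le> levi r V z)))"


section \<open>Strict type 4\<close>

text \<open>The function \<open>\<lambda> = H\<^sub>r(L,L)\<close> on the boundary is differentiated through its extension
  \<open>levi r L\<close> to \<open>U\<close>. As \<open>L\<close> and its conjugate are tangential, both second derivatives below depend,
  at boundary points, only on the restriction of \<open>\<lambda>\<close> to the boundary. At a point of weak
  pseudoconvexity \<open>\<lambda>\<close> has a local minimum along the boundary, so the commutator of \<open>L\<close> with its
  conjugate annihilates \<open>\<lambda>\<close> there and the left-hand side is a real number.\<close>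

definition strict_type_4 :: "(complex ^ 2) set \<Rightarrow> complex ^ 2 \<Rightarrow> bool" where
  "strict_type_4 \<Omega> p \<longleftrightarrow>
     weakly_pseudoconvex_at \<Omega> p \<and>
     (\<exists>U r L. local_defining_function \<Omega> p U r \<and> tangential_vf \<Omega> r U L \<and> (\<forall>z \<in> U. L z \<noteq> 0) \<and>
        (let lam = (\<lambda>z. complex_of_real (levi r L z)) in
          Re (vf_apply L (vf_conj_apply L lam) p) > cmod (vf_apply L (vf_apply L lam) p)))"

end

theory Submission
  imports Defs
begin

text \<open>Write \<open>\<lambda> = H\<^sub>r(L,L)\<close>, let \<open>N\<close> be the field with coefficients \<open>cnj (\<partial>r/\<partial>z\<^sup>j)\<close> and \<open>\<nu> = N r > 0\<close>. For
  \<open>r' = r exp (g + K r)\<close> and \<open>V = a L + b N\<close> one finds on the boundary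
  \<open>H\<^sub>r\<^sub>'(V,V) = e\<^sup>g (|a|\<^sup>2 \<lambda> + 2 Re (a cnj b F) + |b|\<^sup>2 (R + 2 K \<nu>\<^sup>2))\<close> with \<open>F = E + \<nu> L g\<close>, where \<open>E\<close> is the
  Hermitian part of \<open>H\<^sub>r(L,N)\<close> and \<open>R\<close> does not depend on \<open>K\<close>. This is nonnegative for large \<open>K\<close> as soon
  as \<open>|F|\<^sup>2 \<le> const \<lambda>\<close>. Strict type 4 says that the real-linear map \<open>\<gamma> \<mapsto> \<gamma> (L Lbar \<lambda>) + cnj \<gamma> (L L \<lambda>)\<close> is
  invertible near \<open>p\<^sub>0\<close>; hence \<open>g = 2 Re (\<gamma> Lbar \<lambda>)\<close> can be chosen with \<open>F = O(|L \<lambda>|)\<close>, and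
  \<open>|L \<lambda>|\<^sup>2 \<le> const \<lambda>\<close> because \<open>\<lambda>\<close> is nonnegative on the boundary.\<close>

section \<open>Calculus of smooth maps\<close>

lemma has_derivative_frechet:
  "f differentiable (at x) \<Longrightarrow> (f has_derivative frechet_derivative f (at x)) (at x)"
  by (simp add: frechet_derivative_works[symmetric])

lemma frechet_derivative_eqI:
  "(f has_derivative f') (at x) \<Longrightarrow> frechet_derivative f (at x) = f'"
  by (rule frechet_derivative_at[symmetric])

text \<open>\<open>frechet_derivative\<close> is a choice among all \<open>D\<close> satisfying
  \<open>has_derivative\<close>. Both functions admit the same \<open>D\<close>, so the choices
  agree even where neither function is differentiable.\<close>

lemma frechet_derivative_cong_open:
  assumes "open S" "x \<in> S" "\<And>y. y \<in> S \<Longrightarrow> f y = g y"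
  shows "frechet_derivative f (at x) = frechet_derivative g (at x)"
proof -
  have "(f has_derivative D) (at x) \<longleftrightarrow> (g has_derivative D) (at x)" for D
    using has_derivative_transform_within_open[OF _ assms(1,2), of f D UNIV g]
      has_derivative_transform_within_open[OF _ assms(1,2), of g D UNIV f] assms(3) by auto
  then show ?thesis by (simp add: frechet_derivative_def)
qed

lemma differentiable_cong_open:
  assumes "open S" "x \<in> S" "\<And>y. y \<in> S \<Longrightarrow> f y = g y" "f differentiable (at x)"
  shows "g differentiable (at x)"
  using assms(4) has_derivative_transform_within_open[OF _ assms(1,2), of f _ UNIV g] assms(3)
  unfolding differentiable_def by auto

section \<open>The classes \<open>Ck_on\<close> and their closure properties\<close>

lemma Ck_on_cong:
  assumes "open S" "\<And>x. x \<in> S \<Longrightarrow> f x = g x" "Ck_on k S f"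
  shows "Ck_on k S g"
  using assms(2,3)
proof (induction k arbitrary: f g)
  case 0
  then show ?case by (simp cong: continuous_on_cong)
next
  case (Suc k)
  have "Ck_on k S (\<lambda>x. frechet_derivative g (at x) v)" for v
    using Suc.IH[of "\<lambda>x. frechet_derivative f (at x) v" "\<lambda>x. frechet_derivative g (at x) v"]
      frechet_derivative_cong_open[OF assms(1) _ Suc.prems(1)] Suc.prems(2) by simp
  moreover have "g differentiable (at x)" if "x \<in> S" for x
    using differentiable_cong_open[OF assms(1) that Suc.prems(1)] Suc.prems(2) that by simp
  ultimately show ?case by simp
qed

text \<open>Lets each closure proof below work with an explicit formula for the derivative in place
  of the chosen \<open>frechet_derivative\<close>.\<close>

lemma Ck_on_SucI:
  assumes "open S" "\<And>x. x \<in> S \<Longrightarrow> (f has_derivative f' x) (at x)" "\<And>v. Ck_on k S (\<lambda>x. f' x v)"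
  shows "Ck_on (Suc k) S f"
proof -
  have "Ck_on k S (\<lambda>x. frechet_derivative f (at x) v)" for v
    by (rule Ck_on_cong[OF assms(1) _ assms(3)[of v]])
      (simp add: frechet_derivative_eqI[OF assms(2)])
  then show ?thesis using assms(2) by (auto simp: differentiable_def)
qed

lemma Ck_on_SucD: "Ck_on (Suc k) S f \<Longrightarrow> Ck_on k S f"
proof (induction k arbitrary: f)
  case 0
  then show ?case
    by (auto simp: continuous_on_eq_continuous_within
        intro: differentiable_imp_continuous_within differentiable_at_withinI)
qed auto

lemma Ck_on_Suc_has_derivative:
  "Ck_on (Suc k) S f \<Longrightarrow> x \<in> S \<Longrightarrow> (f has_derivative frechet_derivative f (at x)) (at x)"
  by (simp add: has_derivative_frechet)

lemma Ck_on_const: "Ck_on k S (\<lambda>x. c)"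
  by (induction k arbitrary: c) auto

lemma Ck_on_bounded_linear:
  assumes "open S" "bounded_linear h" "Ck_on k S f"
  shows "Ck_on k S (\<lambda>x. h (f x))"
  using assms(3)
proof (induction k arbitrary: f)
  case 0
  then show ?case using bounded_linear.continuous_on[OF assms(2)] by simp
next
  case (Suc k)
  show ?case
  proof (rule Ck_on_SucI[OF assms(1), where f' = "\<lambda>x v. h (frechet_derivative f (at x) v)"])
    show "((\<lambda>x. h (f x)) has_derivative (\<lambda>v. h (frechet_derivative f (at x) v))) (at x)"
      if "x \<in> S" for x
      by (rule bounded_linear.has_derivative[OF assms(2) Ck_on_Suc_has_derivative[OF Suc.prems that]])
  qed (use Suc in auto)
qed

lemma Ck_on_add:
  assumes "open S" "Ck_on k S f" "Ck_on k S g"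
  shows "Ck_on k S (\<lambda>x. f x + g x)"
  using assms(2,3)
proof (induction k arbitrary: f g)
  case 0
  then show ?case by (auto intro: continuous_intros)
next
  case (Suc k)
  show ?case
    by (rule Ck_on_SucI[OF assms(1)
          has_derivative_add[OF Ck_on_Suc_has_derivative[OF Suc.prems(1)]
            Ck_on_Suc_has_derivative[OF Suc.prems(2)]]])
      (use Suc in auto)
qed

text \<open>In the Leibniz rule one factor is differentiated and the other is kept;
  \<open>Ck_on_SucD\<close> lowers the kept one to order \<open>k\<close>, so the induction closes
  over arbitrary pairs.\<close>

lemma Ck_on_bilinear:
  assumes "open S" "bounded_bilinear pr" "Ck_on k S f" "Ck_on k S g"
  shows "Ck_on k S (\<lambda>x. pr (f x) (g x))"
  using assms(3,4)
proof (induction k arbitrary: f g)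
  case 0
  then show ?case by (auto intro: bounded_bilinear.continuous_on[OF assms(2)])
next
  case (Suc k)
  show ?case
  proof (rule Ck_on_SucI[OF assms(1)
          bounded_bilinear.FDERIV[OF assms(2) Ck_on_Suc_has_derivative[OF Suc.prems(1)]
            Ck_on_Suc_has_derivative[OF Suc.prems(2)]]])
    show "Ck_on k S (\<lambda>x. pr (f x) (frechet_derivative g (at x) v) + pr (frechet_derivative f (at x) v) (g x))" for v
      by (rule Ck_on_add[OF assms(1) Suc.IH Suc.IH])
        (use Suc.prems Ck_on_SucD[OF Suc.prems(1)] Ck_on_SucD[OF Suc.prems(2)] in auto)
  qed
qed

lemmas Ck_on_mult = Ck_on_bilinear[OF _ bounded_bilinear_mult]

text \<open>The derivative of \<open>exp (f x)\<close> contains \<open>exp (f x)\<close> again, so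
  the induction runs with \<open>f\<close> fixed.\<close>

lemma Ck_on_exp:
  fixes f :: "_ \<Rightarrow> real"
  assumes "open S" "Ck_on k S f"
  shows "Ck_on k S (\<lambda>x. exp (f x))"
  using assms(2)
proof (induction k)
  case 0
  then show ?case by (auto intro: continuous_intros)
next
  case (Suc k)
  show ?case
  proof (rule Ck_on_SucI[OF assms(1) has_derivative_exp[OF Ck_on_Suc_has_derivative[OF Suc.prems]]])
    show "Ck_on k S (\<lambda>x. frechet_derivative f (at x) v * exp (f x))" for v
      by (rule Ck_on_mult[OF assms(1)]) (use Suc Ck_on_SucD[OF Suc.prems] in auto)
  qed auto
qed

lemma Ck_on_inverse:
  fixes f :: "_ \<Rightarrow> real"
  assumes "open S" "Ck_on k S f" "\<And>x. x \<in> S \<Longrightarrow> f x \<noteq> 0"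
  shows "Ck_on k S (\<lambda>x. inverse (f x))"
  using assms(2)
proof (induction k)
  case 0
  then show ?case using assms(3) by (auto intro!: continuous_intros)
next
  case (Suc k)
  show ?case
  proof (rule Ck_on_SucI[OF assms(1) Deriv.has_derivative_inverse[OF assms(3) Ck_on_Suc_has_derivative[OF Suc.prems]]])
    have "Ck_on k S (\<lambda>x. inverse (f x))" "Ck_on k S (\<lambda>x. frechet_derivative f (at x) v)" for v
      using Suc Ck_on_SucD[OF Suc.prems] by auto
    then show "Ck_on k S (\<lambda>x. - (inverse (f x) * frechet_derivative f (at x) v * inverse (f x)))" for v
      by (intro Ck_on_bounded_linear[OF assms(1) bounded_linear_minus[OF bounded_linear_ident]]
           Ck_on_mult[OF assms(1)])
  qed auto
qed

named_theorems smooth_intros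

section \<open>Closure rules for smooth maps\<close>

lemma smooth_on_const [smooth_intros]: "smooth_on S (\<lambda>x. c)"
  by (simp add: smooth_on_def Ck_on_const)

lemma smooth_on_bounded_linear:
  "bounded_linear h \<Longrightarrow> open S \<Longrightarrow> smooth_on S f \<Longrightarrow> smooth_on S (\<lambda>x. h (f x))"
  by (simp add: smooth_on_def Ck_on_bounded_linear)

lemmas smooth_on_minus [smooth_intros] =
    smooth_on_bounded_linear[OF bounded_linear_minus[OF bounded_linear_ident]]
  and smooth_on_Re [smooth_intros] = smooth_on_bounded_linear[OF bounded_linear_Re]
  and smooth_on_of_real [smooth_intros] = smooth_on_bounded_linear[OF bounded_linear_of_real]
  and smooth_on_cnj [smooth_intros] = smooth_on_bounded_linear[OF bounded_linear_cnj]
  and smooth_on_vec_nth [smooth_intros] = smooth_on_bounded_linear[OF bounded_linear_vec_nth]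

lemma smooth_on_add [smooth_intros]:
  "open S \<Longrightarrow> smooth_on S f \<Longrightarrow> smooth_on S g \<Longrightarrow> smooth_on S (\<lambda>x. f x + g x)"
  by (simp add: smooth_on_def Ck_on_add)

lemma smooth_on_diff [smooth_intros]:
  "open S \<Longrightarrow> smooth_on S f \<Longrightarrow> smooth_on S g \<Longrightarrow> smooth_on S (\<lambda>x. f x - g x)"
  using smooth_on_add[OF _ _ smooth_on_minus, of S f g] by simp

lemma smooth_on_mult [smooth_intros]:
  fixes f g :: "'a::euclidean_space \<Rightarrow> 'b::{real_normed_algebra, euclidean_space}"
  shows "open S \<Longrightarrow> smooth_on S f \<Longrightarrow> smooth_on S g \<Longrightarrow> smooth_on S (\<lambda>x. f x * g x)"
  by (simp add: smooth_on_def Ck_on_mult)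

lemma smooth_on_sum [smooth_intros]:
  "open S \<Longrightarrow> (\<And>i. i \<in> I \<Longrightarrow> smooth_on S (f i)) \<Longrightarrow> smooth_on S (\<lambda>x. \<Sum>i\<in>I. f i x)"
  by (induction I rule: infinite_finite_induct) (auto intro: smooth_intros)

lemma smooth_on_exp [smooth_intros]:
  fixes f :: "_ \<Rightarrow> real"
  shows "open S \<Longrightarrow> smooth_on S f \<Longrightarrow> smooth_on S (\<lambda>x. exp (f x))"
  by (simp add: smooth_on_def Ck_on_exp)

lemma smooth_on_inverse [smooth_intros]:
  fixes f :: "_ \<Rightarrow> real"
  shows "open S \<Longrightarrow> smooth_on S f \<Longrightarrow> (\<And>x. x \<in> S \<Longrightarrow> f x \<noteq> 0) \<Longrightarrow> smooth_on S (\<lambda>x. inverse (f x))"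
  by (simp add: smooth_on_def Ck_on_inverse)

lemma smooth_on_frechet [smooth_intros]:
  assumes "smooth_on S f"
  shows "smooth_on S (\<lambda>x. frechet_derivative f (at x) v)"
proof -
  have "Ck_on (Suc k) S f" for k
    using assms by (simp add: smooth_on_def)
  then show ?thesis by (simp add: smooth_on_def)
qed

lemma Ck_on_subset: "Ck_on k S f \<Longrightarrow> T \<subseteq> S \<Longrightarrow> Ck_on k T f"
  by (induction k arbitrary: f) (auto intro: continuous_on_subset)

lemma smooth_on_subset: "smooth_on S f \<Longrightarrow> T \<subseteq> S \<Longrightarrow> smooth_on T f"
  by (auto simp: smooth_on_def intro: Ck_on_subset)

lemma smooth_on_differentiable: "smooth_on S f \<Longrightarrow> x \<in> S \<Longrightarrow> f differentiable (at x)"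
  unfolding smooth_on_def by (drule spec[of _ "Suc 0"]) simp

lemma smooth_on_has_derivative:
  "smooth_on S f \<Longrightarrow> x \<in> S \<Longrightarrow> (f has_derivative frechet_derivative f (at x)) (at x)"
  by (simp add: has_derivative_frechet smooth_on_differentiable)

lemma smooth_on_continuous: "smooth_on S f \<Longrightarrow> continuous_on S f"
  unfolding smooth_on_def by (drule spec[of _ 0]) simp

section \<open>Uniform estimates on closed balls\<close>

lemma smooth_on_bounded_cball:
  assumes "smooth_on S f" "cball p \<rho> \<subseteq> S"
  obtains C where "C > 0" "\<And>x. x \<in> cball p \<rho> \<Longrightarrow> norm (f x) \<le> C"
proof -
  have "compact (f ` cball p \<rho>)"
    using continuous_on_subset[OF smooth_on_continuous[OF assms(1)] assms(2)]
    by (intro compact_continuous_image) auto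
  then have "bounded (f ` cball p \<rho>)" by (rule compact_imp_bounded)
  then obtain C where "C > 0" "\<forall>y\<in>f ` cball p \<rho>. norm y \<le> C" unfolding bounded_pos by blast
  then show ?thesis by (intro that[of C]) (simp_all del: mem_cball)
qed

text \<open>Second derivatives are bounded on the compact ball, so the first derivative is Lipschitz
  there. The mean value inequality for the linearization, on a segment inside the convex ball, then
  gives a quadratic remainder uniform in the base point.\<close>

lemma smooth_on_taylor2:
  fixes f :: "'a::euclidean_space \<Rightarrow> 'b::euclidean_space"
  assumes "smooth_on S f" "cball p \<rho> \<subseteq> S"
  obtains C where "C > 0" "\<And>x y. x \<in> cball p \<rho> \<Longrightarrow> y \<in> cball p \<rho> \<Longrightarrow>
    norm (f y - f x - frechet_derivative f (at x) (y - x)) \<le> C * (norm (y - x))\<^sup>2"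
proof -
  let ?D = "\<lambda>g x. frechet_derivative g (at x)"
  have lip: "\<exists>C>0. \<forall>x\<in>cball p \<rho>. \<forall>y\<in>cball p \<rho>. norm (?D f y i - ?D f x i) \<le> C * norm (y - x)" for i
  proof -
    let ?g = "\<lambda>x. ?D f x i"
    have sg: "smooth_on S ?g" by (rule smooth_on_frechet[OF assms(1)])
    have "\<exists>C>0. \<forall>x\<in>cball p \<rho>. norm (?D ?g x b) \<le> C" for b
      by (rule smooth_on_bounded_cball[OF smooth_on_frechet[OF sg, of b] assms(2)]) blast
    then have "\<forall>b. \<exists>C. C > 0 \<and> (\<forall>x\<in>cball p \<rho>. norm (?D ?g x b) \<le> C)" by blast
    from choice[OF this] obtain C where C: "\<And>b. C b > 0"
      "\<And>x b. x \<in> cball p \<rho> \<Longrightarrow> norm (?D ?g x b) \<le> C b"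
      by blast
    \<comment> \<open>The operator norm is at most the sum of the norms on a basis, so one bound per
      basis vector suffices. The summand 1 makes the constant visibly positive.\<close>
    have on: "onorm (?D ?g x) \<le> 1 + (\<Sum>b\<in>Basis. C b)" if "x \<in> cball p \<rho>" for x
    proof -
      have "onorm (?D ?g x) \<le> (\<Sum>b\<in>Basis. norm (?D ?g x b))"
        by (intro onorm_componentwise has_derivative_bounded_linear[OF smooth_on_has_derivative[OF sg]])
          (use that assms(2) in auto)
      also have "\<dots> \<le> (\<Sum>b\<in>Basis. C b)"
        by (rule sum_mono) (use C that in auto)
      finally show ?thesis by simp
    qed
    have "norm (?g y - ?g x) \<le> (1 + (\<Sum>b\<in>Basis. C b)) * norm (y - x)"
      if "x \<in> cball p \<rho>" "y \<in> cball p \<rho>" for x y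
    proof (rule differentiable_bound[of "cball p \<rho>" ?g "?D ?g"])
      show "(?g has_derivative ?D ?g z) (at z within cball p \<rho>)" if "z \<in> cball p \<rho>" for z
        by (rule has_derivative_at_withinI, rule smooth_on_has_derivative[OF sg]) (use that assms(2) in auto)
    qed (use that on in auto)
    moreover have "1 + (\<Sum>b\<in>Basis. C b) > 0"
      using C(1) by (intro add_pos_nonneg sum_nonneg) (auto intro: less_imp_le)
    ultimately show ?thesis by blast
  qed
  then have "\<forall>i. \<exists>C. C > 0 \<and>
      (\<forall>x\<in>cball p \<rho>. \<forall>y\<in>cball p \<rho>. norm (?D f y i - ?D f x i) \<le> C * norm (y - x))"
    by blast
  from choice[OF this] obtain C where C: "\<And>i. C i > 0"
    "\<And>x y i. x \<in> cball p \<rho> \<Longrightarrow> y \<in> cball p \<rho> \<Longrightarrow> norm (?D f y i - ?D f x i) \<le> C i * norm (y - x)"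
    by blast
  define K where "K = 1 + (\<Sum>b\<in>Basis. C b)"
  have K: "K > 0" unfolding K_def
    using C(1) by (intro add_pos_nonneg sum_nonneg) (auto intro: less_imp_le)
  have "norm (f y - f x - ?D f x (y - x)) \<le> K * (norm (y - x))\<^sup>2"
    if xy: "x \<in> cball p \<rho>" "y \<in> cball p \<rho>" for x y
  proof -
    have bl: "bounded_linear (?D f z)" if "z \<in> cball p \<rho>" for z
      by (rule has_derivative_bounded_linear[OF smooth_on_has_derivative[OF assms(1)]]) (use that assms(2) in auto)
    have "norm (f y - f x - ?D f x (y - x)) \<le> norm (y - x) * (K * norm (y - x))"
    proof (rule differentiable_bound_linearization[where S = "closed_segment x y"])
      show "x + t *\<^sub>R (y - x) \<in> closed_segment x y" if "t \<in> {0..1}" for t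
        using that by (auto simp: closed_segment_def algebra_simps intro!: exI[of _ t])
      fix z assume "z \<in> closed_segment x y"
      then have z: "z \<in> cball p \<rho>" "norm (z - x) \<le> norm (y - x)"
        using closed_segment_subset[OF xy convex_cball] segment_bound[of z x y]
        by (auto simp: dist_norm norm_minus_commute)
      show "(f has_derivative ?D f z) (at z within closed_segment x y)"
        by (rule has_derivative_at_withinI, rule smooth_on_has_derivative[OF assms(1)])
          (use z(1) assms(2) in auto)
      have "onorm (?D f z - ?D f x) \<le> (\<Sum>b\<in>Basis. norm ((?D f z - ?D f x) b))"
        using bounded_linear_sub[OF bl[OF z(1)] bl[OF xy(1)]] 
        by (intro onorm_componentwise) (simp add: fun_diff_def)
      also have "\<dots> \<le> (\<Sum>b\<in>Basis. C b * norm (z - x))"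
        by (rule sum_mono) (use C(2)[OF xy(1) z(1)] in simp)
      also have "\<dots> = (K - 1) * norm (z - x)" by (simp add: K_def sum_distrib_right)
      also have "\<dots> \<le> K * norm (z - x)" by (simp add: mult_right_mono)
      also have "\<dots> \<le> K * norm (y - x)" using z(2) K by simp
      finally show "onorm (?D f z - ?D f x) \<le> K * norm (y - x)" .
    qed simp
    then show ?thesis by (simp add: power2_eq_square ac_simps)
  qed
  with K that show ?thesis by blast
qed

section \<open>Wirtinger calculus\<close>

lemma frechet_of_real:
  assumes "f differentiable (at p)"
  shows "frechet_derivative (\<lambda>z. complex_of_real (f z)) (at p) = (\<lambda>v. of_real (frechet_derivative f (at p) v))"
  by (rule frechet_derivative_eqI, rule has_derivative_of_real, rule has_derivative_frechet[OF assms])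

lemma dz_cong_open:
  assumes "open S" "p \<in> S" "\<And>z. z \<in> S \<Longrightarrow> f z = g z"
  shows "dz j f p = dz j g p" "dzbar j f p = dzbar j g p"
  using frechet_derivative_cong_open[of S p f g, OF assms] by (simp_all add: dz_def dzbar_def)

lemma dz_add:
  assumes "f differentiable (at p)" "g differentiable (at p)"
  shows "dz j (\<lambda>z. f z + g z) p = dz j f p + dz j g p"
    and "dzbar j (\<lambda>z. f z + g z) p = dzbar j f p + dzbar j g p"
  unfolding dz_def dzbar_def
    frechet_derivative_eqI[OF has_derivative_add[OF assms[THEN has_derivative_frechet]]]
  by (simp_all add: field_simps)

lemma dz_mult:
  assumes "f differentiable (at p)" "g differentiable (at p)"
  shows "dz j (\<lambda>z. f z * g z) p = f p * dz j g p + dz j f p * g p"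
    and "dzbar j (\<lambda>z. f z * g z) p = f p * dzbar j g p + dzbar j f p * g p"
  unfolding dz_def dzbar_def
    frechet_derivative_eqI[OF has_derivative_mult[OF assms[THEN has_derivative_frechet]]]
  by (simp_all add: field_simps)

lemma dz_const [simp]: "dz j (\<lambda>z. c) p = 0" "dzbar j (\<lambda>z. c) p = 0"
  by (simp_all add: dz_def dzbar_def)

lemma dzbar_of_real:
  assumes "f differentiable (at p)"
  shows "dzbar j (\<lambda>z. complex_of_real (f z)) p = cnj (dz j (\<lambda>z. complex_of_real (f z)) p)"
  unfolding dz_def dzbar_def frechet_of_real[OF assms] by simp

lemma dz_sum:
  assumes "\<And>i. i \<in> I \<Longrightarrow> f i differentiable (at p)"
  shows "dz j (\<lambda>z. \<Sum>i\<in>I. f i z) p = (\<Sum>i\<in>I. dz j (f i) p)"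
proof -
  have "frechet_derivative (\<lambda>z. \<Sum>i\<in>I. f i z) (at p) = (\<lambda>v. \<Sum>i\<in>I. frechet_derivative (f i) (at p) v)"
    by (rule frechet_derivative_eqI, rule has_derivative_sum, rule has_derivative_frechet[OF assms])
  then show ?thesis
    by (simp add: dz_def sum_subtractf[symmetric] sum_distrib_left sum_divide_distrib)
qed

lemma dz_exp:
  fixes f :: "complex ^ 'n \<Rightarrow> real"
  assumes "f differentiable (at p)"
  shows "dz j (\<lambda>z. complex_of_real (exp (f z))) p = of_real (exp (f p)) * dz j (\<lambda>z. of_real (f z)) p"
proof -
  have d: "((\<lambda>z. exp (f z)) has_derivative (\<lambda>v. frechet_derivative f (at p) v * exp (f p))) (at p)"
    by (rule has_derivative_exp[OF has_derivative_frechet[OF assms]])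
  then have "(\<lambda>z. exp (f z)) differentiable (at p)" by (auto simp: differentiable_def)
  then show ?thesis
    by (simp add: dz_def frechet_of_real[OF assms] frechet_of_real frechet_derivative_eqI[OF d] field_simps)
qed

lemma smooth_on_dz [smooth_intros]:
  assumes "open S" "smooth_on S f"
  shows "smooth_on S (dz j f)" "smooth_on S (dzbar j f)"
proof -
  \<comment> \<open>Division by 2 is rewritten as a product with a constant, a form the closure
    rules cover.\<close>
  have "smooth_on S (\<lambda>p. (1/2) * (frechet_derivative f (at p) (axis j 1) - \<i> * frechet_derivative f (at p) (axis j \<i>)))"
    "smooth_on S (\<lambda>p. (1/2) * (frechet_derivative f (at p) (axis j 1) + \<i> * frechet_derivative f (at p) (axis j \<i>)))"
    by (intro smooth_intros assms)+
  then show "smooth_on S (dz j f)" "smooth_on S (dzbar j f)"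
    by (simp_all add: dz_def[abs_def] dzbar_def[abs_def])
qed

lemma vec_complex_expand:
  fixes v :: "complex ^ 'n"
  shows "v = (\<Sum>j\<in>UNIV. Re (v $ j) *\<^sub>R axis j 1 + Im (v $ j) *\<^sub>R axis j \<i>)"
proof (rule vec_eq_iff[THEN iffD2, rule_format])
  fix k
  have "(\<Sum>j\<in>UNIV. Re (v $ j) *\<^sub>R axis j 1 + Im (v $ j) *\<^sub>R axis j \<i>) $ k
     = (\<Sum>j\<in>UNIV. if j = k then v $ k else 0)"
    unfolding sum_component
    by (rule sum.cong) (auto simp: axis_def complex_eq_iff)
  then show "v $ k = (\<Sum>j\<in>UNIV. Re (v $ j) *\<^sub>R axis j 1 + Im (v $ j) *\<^sub>R axis j \<i>) $ k"
    by simp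
qed

lemma linear_complex_vec_expand:
  fixes T :: "complex ^ 'n \<Rightarrow> complex"
  assumes "linear T"
  shows "T v = (\<Sum>j\<in>UNIV. Re (v $ j) * T (axis j 1) + Im (v $ j) * T (axis j \<i>))"
  by (subst vec_complex_expand)
    (simp add: linear_sum[OF assms] linear_add[OF assms] linear_scale[OF assms] scaleR_conv_of_real[where 'a=complex])

text \<open>Splits the action of a (1,0) field into two real directional derivatives, along
  \<open>L\<close> and \<open>\<i> *s L\<close>; these are the directions in which real curves on
  the boundary can be used.\<close>

lemma vf_apply_frechet:
  assumes "f differentiable (at p)"
  shows "vf_apply L f p =
      (frechet_derivative f (at p) (L p) - \<i> * frechet_derivative f (at p) (\<i> *s L p)) / 2"
    and "vf_conj_apply L f p =
      (frechet_derivative f (at p) (L p) + \<i> * frechet_derivative f (at p) (\<i> *s L p)) / 2"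
proof -
  let ?T = "frechet_derivative f (at p)"
  have L: "linear ?T" by (rule linear_frechet_derivative[OF assms])
  have c: "L p $ j = Re (L p $ j) + \<i> * Im (L p $ j)"
    "cnj (L p $ j) = Re (L p $ j) - \<i> * Im (L p $ j)" for j
    by (simp_all add: complex_eq_iff)
  show "vf_apply L f p = (?T (L p) - \<i> * ?T (\<i> *s L p)) / 2"
    unfolding vf_apply_def dz_def linear_complex_vec_expand[OF L, of "L p"]
      linear_complex_vec_expand[OF L, of "\<i> *s L p"] sum_distrib_left sum_divide_distrib
      sum_subtractf[symmetric]
    by (rule sum.cong[OF refl], subst c(1)) (simp add: field_simps)
  show "vf_conj_apply L f p = (?T (L p) + \<i> * ?T (\<i> *s L p)) / 2"
    unfolding vf_conj_apply_def dzbar_def linear_complex_vec_expand[OF L, of "L p"]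
      linear_complex_vec_expand[OF L, of "\<i> *s L p"] sum_distrib_left sum_divide_distrib
      sum.distrib[symmetric]
    by (rule sum.cong[OF refl], subst c(2)) (simp add: field_simps)
qed

lemma vf_apply_cong_open:
  assumes "open S" "p \<in> S" "\<And>z. z \<in> S \<Longrightarrow> f z = g z"
  shows "vf_apply L f p = vf_apply L g p"
  using dz_cong_open(1)[of S p f g, OF assms] by (simp add: vf_apply_def)

lemma vf_apply_add:
  assumes "f differentiable (at p)" "g differentiable (at p)"
  shows "vf_apply L (\<lambda>z. f z + g z) p = vf_apply L f p + vf_apply L g p"
  by (simp add: vf_apply_def dz_add[OF assms] algebra_simps sum.distrib)

lemma vf_apply_mult:
  assumes "f differentiable (at p)" "g differentiable (at p)"
  shows "vf_apply L (\<lambda>z. f z * g z) p = f p * vf_apply L g p + vf_apply L f p * g p"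
  by (simp add: vf_apply_def dz_mult[OF assms] algebra_simps sum.distrib sum_distrib_left)

lemma vf_apply_const [simp]: "vf_apply L (\<lambda>z. c) p = 0"
  by (simp add: vf_apply_def)

lemma vf_conj_apply_of_real:
  assumes "f differentiable (at p)"
  shows "vf_conj_apply L (\<lambda>z. complex_of_real (f z)) p = cnj (vf_apply L (\<lambda>z. complex_of_real (f z)) p)"
  by (simp add: vf_conj_apply_def vf_apply_def dzbar_of_real[OF assms])

lemma vf_apply_sum:
  assumes "\<And>i. i \<in> I \<Longrightarrow> f i differentiable (at p)"
  shows "vf_apply L (\<lambda>z. \<Sum>i\<in>I. f i z) p = (\<Sum>i\<in>I. vf_apply L (f i) p)"
  unfolding vf_apply_def by (subst dz_sum[OF assms]) (auto simp: sum_distrib_left intro: sum.swap)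

lemma smooth_on_vf_apply [smooth_intros]:
  assumes "open S" "smooth_on S L" "smooth_on S f"
  shows "smooth_on S (vf_apply L f)" "smooth_on S (vf_conj_apply L f)"
  unfolding vf_apply_def[abs_def] vf_conj_apply_def[abs_def] by (intro smooth_intros assms)+

lemma smooth_on_complex_hessian [smooth_intros]:
  assumes "open S" "smooth_on S f" "\<And>j. smooth_on S (\<lambda>z. A z $ j)" "\<And>j. smooth_on S (\<lambda>z. B z $ j)"
  shows "smooth_on S (complex_hessian f A B)"
  unfolding complex_hessian_def[abs_def] by (intro smooth_intros assms)

section \<open>Complex Hessians of combinations and products\<close>

lemma complex_hessian_combination:
  assumes "V p = a *s A p + b *s B p"
  shows "complex_hessian f V V p = a * cnj a * complex_hessian f A A p
    + a * cnj b * complex_hessian f A B p + b * cnj a * complex_hessian f B A p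
    + b * cnj b * complex_hessian f B B p"
  unfolding complex_hessian_def assms sum_distrib_left sum.distrib[symmetric]
  by (intro sum.cong refl) (simp add: algebra_simps)

text \<open>Leibniz rule for a mixed second derivative; the term carrying the Hessian of
  \<open>h\<close> has the factor \<open>r p = 0\<close> and drops out.\<close>

lemma complex_hessian_mult_at_zero:
  assumes S: "open S" "p \<in> S" and r: "smooth_on S r" and h: "smooth_on S h" and "r p = 0"
  shows "complex_hessian (\<lambda>z. r z * h z) A B p = h p * complex_hessian r A B p
    + vf_apply A (\<lambda>z. of_real (r z)) p * cnj (vf_apply B (\<lambda>z. of_real (h z)) p)
    + vf_apply A (\<lambda>z. of_real (h z)) p * cnj (vf_apply B (\<lambda>z. of_real (r z)) p)"
proof -
  let ?r = "\<lambda>z. complex_of_real (r z)" and ?h = "\<lambda>z. complex_of_real (h z)"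
  have R: "smooth_on S ?r" and H: "smooth_on S ?h" by (intro smooth_intros S r h)+
  have d: "g differentiable (at z)" if "smooth_on S g" "z \<in> S" for g :: "_ \<Rightarrow> complex" and z
    using smooth_on_differentiable[OF that] .
  have "dz j (dzbar k (\<lambda>z. of_real (r z * h z))) p
      = h p * dz j (dzbar k ?r) p + dz j ?r p * cnj (dz k ?h p) + dz j ?h p * cnj (dz k ?r p)" for j k
  proof -
    \<comment> \<open>The inner product rule must hold throughout \<open>S\<close>, not only at
      \<open>p\<close>, because it is differentiated once more.\<close>
    have "dz j (dzbar k (\<lambda>z. of_real (r z * h z))) p = dz j (\<lambda>z. ?r z * dzbar k ?h z + dzbar k ?r z * ?h z) p"
      by (rule dz_cong_open[OF S]) (simp add: dz_mult d R H)
    also have "\<dots> = ?r p * dz j (dzbar k ?h) p + dz j ?r p * dzbar k ?h p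
        + (dzbar k ?r p * dz j ?h p + dz j (dzbar k ?r) p * ?h p)"
      using d[OF R S(2)] d[OF H S(2)] d[OF smooth_on_dz(2)[OF S(1) R] S(2)] d[OF smooth_on_dz(2)[OF S(1) H] S(2)]
      by (simp add: dz_add dz_mult differentiable_mult)
    finally show ?thesis
      using \<open>r p = 0\<close> smooth_on_differentiable[OF r S(2)] smooth_on_differentiable[OF h S(2)]
      by (simp add: dzbar_of_real algebra_simps)
  qed
  moreover have "vf_apply A f p * cnj (vf_apply B g p)
      = (\<Sum>j\<in>UNIV. \<Sum>k\<in>UNIV. dz j f p * cnj (dz k g p) * A p $ j * cnj (B p $ k))" for f g
    by (simp add: vf_apply_def sum_product mult_ac)
  ultimately show ?thesis
    by (simp add: complex_hessian_def sum_distrib_left sum.distrib[symmetric] algebra_simps)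
qed

text \<open>Differentiate \<open>cnj (L r) = 0\<close> in the direction of \<open>L\<close>.\<close>

lemma complex_hessian_eq_first_order:
  assumes S: "open S" "p \<in> S" and r: "smooth_on S r" and L: "smooth_on S L"
    and "vf_apply L (\<lambda>z. cnj (vf_apply L (\<lambda>w. of_real (r w)) z)) p = 0"
  shows "complex_hessian r L L p =
    - (\<Sum>k\<in>UNIV. vf_apply L (\<lambda>z. cnj (L z $ k)) p * cnj (dz k (\<lambda>w. of_real (r w)) p))"
proof -
  let ?r = "\<lambda>z. complex_of_real (r z)"
  have R: "smooth_on S ?r" by (intro smooth_intros S r)
  have dr: "dzbar k ?r differentiable (at p)" and dL: "(\<lambda>z. cnj (L z $ k)) differentiable (at p)" for k
    by (rule smooth_on_differentiable[OF _ S(2)], intro smooth_intros S R L)+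
  have "0 = vf_apply L (\<lambda>z. \<Sum>k\<in>UNIV. cnj (L z $ k) * dzbar k ?r z) p"
    unfolding assms(5)[symmetric]
    by (rule vf_apply_cong_open[OF S])
      (simp add: vf_apply_def dzbar_of_real smooth_on_differentiable[OF r])
  also have "\<dots> = (\<Sum>k\<in>UNIV. cnj (L p $ k) * vf_apply L (dzbar k ?r) p
      + vf_apply L (\<lambda>z. cnj (L z $ k)) p * dzbar k ?r p)"
    by (subst vf_apply_sum) (auto intro: differentiable_mult dr dL simp: vf_apply_mult dr dL)
  \<comment> \<open>All second derivatives of \<open>r\<close> are collected in the Hessian; what is
    left involves only first derivatives of \<open>r\<close>.\<close>
  also have "\<dots> = complex_hessian r L L p + (\<Sum>k\<in>UNIV. vf_apply L (\<lambda>z. cnj (L z $ k)) p * cnj (dz k ?r p))"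
    unfolding sum.distrib complex_hessian_def vf_apply_def
      dzbar_of_real[OF smooth_on_differentiable[OF r S(2)]] sum_distrib_left
    by (subst sum.swap) (simp add: mult_ac)
  finally show ?thesis by (simp add: eq_neg_iff_add_eq_0)
qed

section \<open>The boundary near a point\<close>

lemma has_real_derivative_along_line:
  fixes f :: "'a::real_normed_vector \<Rightarrow> real"
  assumes "f differentiable (at (z + t *\<^sub>R n))"
  shows "((\<lambda>t. f (z + t *\<^sub>R n)) has_real_derivative frechet_derivative f (at (z + t *\<^sub>R n)) n) (at t)"
proof -
  let ?D = "frechet_derivative f (at (z + t *\<^sub>R n))"
  have "((\<lambda>t. z + t *\<^sub>R n) has_derivative (\<lambda>s. s *\<^sub>R n)) (at t)"
    by (auto intro!: derivative_eq_intros)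
  from has_derivative_compose[OF this has_derivative_frechet[OF assms]]
  have "((\<lambda>t. f (z + t *\<^sub>R n)) has_derivative (\<lambda>s. ?D (s *\<^sub>R n))) (at t)" .
  moreover have "(\<lambda>s. ?D (s *\<^sub>R n)) = (*) (?D n)"
    using linear_scale[OF linear_frechet_derivative[OF assms]] by (simp add: fun_eq_iff mult.commute)
  ultimately show ?thesis by (simp add: has_field_derivative_def)
qed

text \<open>A frontier point of an open set lies outside it, so \<open>r z\<close> is not negative.
  If it were positive, it would stay positive near \<open>z\<close>, and \<open>\<Omega>\<close>
  would miss a neighbourhood of a point of its closure.\<close>

lemma defining_function_eq_zero:
  assumes "open \<Omega>" and ldf: "local_defining_function \<Omega> p U r" and z: "z \<in> U" "z \<in> frontier \<Omega>"
  shows "r z = 0"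
proof (rule ccontr)
  assume "r z \<noteq> 0"
  moreover have "z \<notin> \<Omega>" using z(2) assms(1) by (simp add: frontier_def interior_open)
  moreover have U: "open U" "\<Omega> \<inter> U = {z \<in> U. r z < 0}" "continuous_on U r"
    using ldf by (auto simp: local_defining_function_def intro: smooth_on_continuous)
  ultimately have "r z > 0" using z(1) by force
  define S where "S = U \<inter> r -` {0<..}"
  have "open S" unfolding S_def using U by (intro continuous_open_preimage) auto
  moreover have "z \<in> S" using \<open>r z > 0\<close> z(1) by (simp add: S_def)
  moreover have "z \<in> closure \<Omega>" using z(2) by (simp add: frontier_def)
  ultimately have "S \<inter> \<Omega> \<noteq> {}" using open_Int_closure_eq_empty[of S \<Omega>] by auto
  then obtain x where "x \<in> \<Omega> \<inter> U" "r x > 0" by (auto simp: S_def)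
  then show False unfolding U(2) by simp
qed

lemma inward_segment_in_domain:
  assumes ldf: "local_defining_function \<Omega> p U r" and z: "z \<in> U" "r z = 0"
    and n: "frechet_derivative r (at z) n > 0"
  obtains d where "d > 0" "\<And>t. 0 < t \<Longrightarrow> t < d \<Longrightarrow> z + (- t) *\<^sub>R n \<in> \<Omega> \<inter> U"
proof -
  have U: "open U" "\<Omega> \<inter> U = {z \<in> U. r z < 0}" "smooth_on U r"
    using ldf by (auto simp: local_defining_function_def)
  have "((\<lambda>t. r (z + t *\<^sub>R n)) has_real_derivative frechet_derivative r (at z) n) (at 0)"
    using has_real_derivative_along_line[of r z 0 n] smooth_on_differentiable[OF U(3) z(1)] by simp
  from DERIV_pos_inc_left[OF this n] obtain d where d: "d > 0"
    "\<And>t. 0 < t \<Longrightarrow> t < d \<Longrightarrow> r (z + (- t) *\<^sub>R n) < 0"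
    using z(2) by auto
  have "open ((\<lambda>t. z + t *\<^sub>R n) -` U)"
    by (intro open_vimage U continuous_intros)
  moreover have "0 \<in> (\<lambda>t. z + t *\<^sub>R n) -` U" using z(1) by simp
  ultimately obtain e where e: "e > 0" "ball 0 e \<subseteq> (\<lambda>t. z + t *\<^sub>R n) -` U" by (meson openE)
  have "z + (- t) *\<^sub>R n \<in> \<Omega> \<inter> U" if "0 < t" "t < min d e" for t
  proof -
    have "- t \<in> (\<lambda>t. z + t *\<^sub>R n) -` U" using that by (intro subsetD[OF e(2)]) simp
    then show ?thesis using d(2)[of t] that unfolding U(2) by simp
  qed
  then show ?thesis using d(1) e(1) by (intro that[of "min d e"]) auto
qed

text \<open>Converse of \<open>defining_function_eq_zero\<close>. A zero of \<open>r\<close> lies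
  outside \<open>\<Omega>\<close>; the direction \<open>n\<close> of increase ensures that points of
  \<open>\<Omega>\<close> accumulate at it.\<close>

lemma zero_in_frontier:
  assumes "open \<Omega>" and ldf: "local_defining_function \<Omega> p U r" and z: "z \<in> U" "r z = 0"
    and n: "frechet_derivative r (at z) n > 0"
  shows "z \<in> frontier \<Omega>"
proof -
  obtain d where d: "d > 0" "\<And>t. 0 < t \<Longrightarrow> t < d \<Longrightarrow> z + (- t) *\<^sub>R n \<in> \<Omega> \<inter> U"
    using inward_segment_in_domain[OF ldf z n] by blast
  have "z \<in> closure \<Omega>"
  proof (unfold closure_approachable, intro allI impI)
    fix \<epsilon> :: real assume "\<epsilon> > 0"
    \<comment> \<open>The first entry keeps the point on the inward segment, the second keeps it
      closer than \<open>\<epsilon>\<close>; adding 1 keeps the denominator positive.\<close>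
    define t where "t = min (d / 2) (\<epsilon> / (1 + norm n))"
    have n1: "1 + norm n > 0" by (simp add: add_pos_nonneg)
    have t: "0 < t" "t < d" using d(1) \<open>\<epsilon> > 0\<close> n1 by (auto simp: t_def)
    have "t * norm n < t * (1 + norm n)" using t(1) by simp
    also have "\<dots> \<le> \<epsilon>" using n1 by (subst pos_le_divide_eq[symmetric]) (auto simp: t_def)
    finally have "dist (z + (- t) *\<^sub>R n) z < \<epsilon>" using t(1) by (simp add: dist_norm)
    then show "\<exists>y\<in>\<Omega>. dist y z < \<epsilon>" using d(2)[OF t] by blast
  qed
  moreover have "z \<notin> \<Omega>"
  proof
    assume "z \<in> \<Omega>"
    then have "z \<in> \<Omega> \<inter> U" using z(1) by simp
    then show False using ldf z(2) unfolding local_defining_function_def by simp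
  qed
  ultimately show ?thesis using assms(1) by (simp add: frontier_def interior_open)
qed

lemma local_defining_function_subset:
  assumes "local_defining_function \<Omega> p U r" "open W" "p \<in> W" "W \<subseteq> U"
  shows "local_defining_function \<Omega> p W r"
  using assms smooth_on_subset[of U r W] unfolding local_defining_function_def by blast

text \<open>Records, with constants uniform in \<open>z\<close> and \<open>v\<close>, that a tangent
  step \<open>v\<close> from a boundary point can be corrected by a second-order multiple of a
  transversal vector \<open>n\<close> so as to land on the boundary. Base points and steps are
  limited by the smaller radius \<open>\<delta>\<close> so that the landing points stay in the ball
  of radius \<open>\<rho>\<close>.\<close>

locale smooth_boundary_point =
  fixes \<Omega> :: "(complex ^ 'n) set" and p U r n \<rho> \<delta> C
  assumes open_domain: "open \<Omega>"
    and ldf: "local_defining_function \<Omega> p U r"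
    and \<rho>: "0 < \<rho>" "cball p \<rho> \<subseteq> U"
    and \<delta>: "0 < \<delta>" "\<delta> \<le> \<rho>"
    and C: "0 < C"
    and transversal: "x \<in> cball p \<rho> \<Longrightarrow> 1 \<le> frechet_derivative r (at x) n"
    and boundary_curve: "z \<in> frontier \<Omega> \<Longrightarrow> z \<in> cball p \<delta> \<Longrightarrow> norm v \<le> \<delta> \<Longrightarrow>
      frechet_derivative r (at z) v = 0 \<Longrightarrow>
      \<exists>s. \<bar>s\<bar> \<le> C * (norm v)\<^sup>2 \<and> z + v + s *\<^sub>R n \<in> frontier \<Omega> \<inter> cball p \<rho>"

text \<open>The correction \<open>s\<close> along the transversal vector \<open>n\<close> comes from the intermediate value theorem:
  \<open>r (z + v)\<close> is of second order in \<open>v\<close>, while \<open>r\<close> grows at least linearly in the direction \<open>n\<close>.\<close>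

lemma smooth_boundary_point_exists:
  fixes \<Omega> :: "(complex ^ 'n) set"
  assumes op: "open \<Omega>" and ldf: "local_defining_function \<Omega> p U r" and p: "p \<in> frontier \<Omega>"
  obtains n \<rho> \<delta> C where "smooth_boundary_point \<Omega> p U r n \<rho> \<delta> C"
proof -
  let ?D = "\<lambda>x. frechet_derivative r (at x)"
  have U: "open U" "p \<in> U" "smooth_on U r" and "?D p \<noteq> (\<lambda>v. 0)"
    using ldf p by (auto simp: local_defining_function_def)
  then obtain m where m: "?D p m \<noteq> 0" by auto
  \<comment> \<open>Normalised to slope 2 at \<open>p\<close>, so that by continuity the slope
    exceeds 1 on a whole neighbourhood.\<close>
  define n where "n = (2 / ?D p m) *\<^sub>R m"
  have lin: "linear (?D x)" if "x \<in> U" for x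
    using linear_frechet_derivative[OF smooth_on_differentiable[OF U(3) that]] .
  have "?D p n = 2" using m by (simp add: n_def linear_scale[OF lin[OF U(2)]])
  define S where "S = U \<inter> (\<lambda>x. ?D x n) -` {1<..}"
  have "open S" unfolding S_def
    by (rule continuous_open_preimage[OF smooth_on_continuous[OF smooth_on_frechet[OF U(3)]] U(1)]) simp
  moreover have "p \<in> S" using U(2) \<open>?D p n = 2\<close> by (simp add: S_def)
  ultimately obtain \<rho> where \<rho>: "\<rho> > 0" "cball p \<rho> \<subseteq> S" by (meson open_contains_cball)
  have \<rho>U: "cball p \<rho> \<subseteq> U" using \<rho>(2) by (auto simp: S_def)
  have trans: "1 \<le> ?D x n" if "x \<in> cball p \<rho>" for x
    using \<rho>(2) that unfolding S_def by fastforce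
  from smooth_on_taylor2[OF U(3) \<rho>U] obtain C where C: "C > 0"
    "\<And>x y. x \<in> cball p \<rho> \<Longrightarrow> y \<in> cball p \<rho> \<Longrightarrow> norm (r y - r x - ?D x (y - x)) \<le> C * (norm (y - x))\<^sup>2"
    by blast
  \<comment> \<open>The two summands \<open>\<delta>\<close> cover the distance of \<open>z\<close>
    from \<open>p\<close> and the step \<open>v\<close>, and \<open>C * norm n * \<delta>\<close>
    covers the correction; together they must not exceed \<open>\<rho>\<close>. The bound 1 gives
    \<open>\<delta>\<^sup>2 \<le> \<delta>\<close>.\<close>
  define \<delta> where "\<delta> = min 1 (\<rho> / (2 + C * norm n))"
  have c: "2 + C * norm n > 0" using C(1) by (simp add: add_pos_nonneg)
  have \<delta>: "\<delta> > 0" "\<delta> \<le> 1" using \<rho>(1) c by (auto simp: \<delta>_def)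
  have \<delta>2: "\<delta> * (2 + C * norm n) \<le> \<rho>"
    using c by (subst pos_le_divide_eq[symmetric]) (auto simp: \<delta>_def)
  have \<delta>3: "2 * \<delta> + C * norm n * \<delta> \<le> \<rho>" using \<delta>2 by (simp add: algebra_simps)
  have "0 \<le> C * norm n * \<delta>" using C(1) \<delta>(1) by simp
  with \<delta>3 \<delta>(1) have \<delta>4: "2 * \<delta> \<le> \<rho>" "\<delta> \<le> \<rho>" by linarith+
  have "\<exists>s. \<bar>s\<bar> \<le> C * (norm v)\<^sup>2 \<and> z + v + s *\<^sub>R n \<in> frontier \<Omega> \<inter> cball p \<rho>"
    if z: "z \<in> frontier \<Omega>" "z \<in> cball p \<delta>" and v: "norm v \<le> \<delta>" "?D z v = 0" for z v
  proof -
    have z\<rho>: "z \<in> cball p \<rho>" using z(2) \<delta>4(2) by simp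
    have "r z = 0" using defining_function_eq_zero[OF op ldf _ z(1)] z\<rho> \<rho>U by auto
    define \<sigma> where "\<sigma> = C * (norm v)\<^sup>2"
    define \<phi> where "\<phi> = (\<lambda>s. r (z + v + s *\<^sub>R n))"
    have "\<sigma> \<ge> 0" using C(1) by (simp add: \<sigma>_def)
    have sq: "(norm v)\<^sup>2 \<le> \<delta>"
    proof -
      have "(norm v)\<^sup>2 \<le> \<delta>\<^sup>2" using v(1) by (simp add: power_mono)
      also have "\<dots> \<le> \<delta>" using \<delta> by (simp add: power2_eq_square mult_left_le)
      finally show ?thesis .
    qed
    have in\<rho>: "z + v + s *\<^sub>R n \<in> cball p \<rho>" if "\<bar>s\<bar> \<le> \<sigma>" for s
    proof -
      have "norm (z + v + s *\<^sub>R n - p) \<le> norm (z - p) + norm v + \<bar>s\<bar> * norm n"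
        using norm_triangle_ineq[of "z - p + v" "s *\<^sub>R n"] norm_triangle_ineq[of "z - p" v]
        by (simp add: algebra_simps)
      also have "\<dots> \<le> \<delta> + \<delta> + (C * \<delta>) * norm n"
        using z(2) v(1) that sq C(1) \<open>\<sigma> \<ge> 0\<close> unfolding \<sigma>_def
        by (intro add_mono mult_right_mono) (auto simp: dist_norm norm_minus_commute intro: order_trans)
      also have "\<dots> \<le> \<rho>" using \<delta>3 by (simp add: mult_ac)
      finally show ?thesis by (simp add: dist_norm norm_minus_commute)
    qed
    have der: "(\<phi> has_real_derivative ?D (z + v + s *\<^sub>R n) n) (at s)" if "\<bar>s\<bar> \<le> \<sigma>" for s
      unfolding \<phi>_def
      by (rule has_real_derivative_along_line, rule smooth_on_differentiable[OF U(3)])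
        (use in\<rho>[OF that] \<rho>U in auto)
    \<comment> \<open>Taylor expansion at \<open>z\<close>: both the value \<open>r z\<close> and
      the linear term \<open>?D z v\<close> vanish.\<close>
    have "\<bar>\<phi> 0\<bar> \<le> \<sigma>"
      using C(2)[OF z\<rho> in\<rho>[of 0]] \<open>\<sigma> \<ge> 0\<close> \<open>r z = 0\<close> v(2) by (simp add: \<phi>_def \<sigma>_def)
    have "\<exists>s\<ge>-\<sigma>. s \<le> \<sigma> \<and> \<phi> s = 0"
    proof (cases "\<sigma> = 0")
      case True
      with \<open>\<bar>\<phi> 0\<bar> \<le> \<sigma>\<close> show ?thesis by auto
    next
      case False
      then have "\<sigma> > 0" using \<open>\<sigma> \<ge> 0\<close> by simp
      \<comment> \<open>Since \<open>\<phi>\<close> has slope at least 1, moving by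
        \<open>\<sigma>\<close> in either direction outweighs the initial value, which produces the
        sign change.\<close>
      have "b - a \<le> \<phi> b - \<phi> a" if "-\<sigma> \<le> a" "a < b" "b \<le> \<sigma>" for a b
      proof -
        have "\<exists>y>a. y < b \<and> \<phi> b - \<phi> a = (b - a) * ?D (z + v + y *\<^sub>R n) n"
          by (rule MVT2[OF that(2)], rule der) (use that in auto)
        then obtain y where y: "a < y" "y < b" "\<phi> b - \<phi> a = (b - a) * ?D (z + v + y *\<^sub>R n) n"
          by blast
        have "(b - a) * 1 \<le> (b - a) * ?D (z + v + y *\<^sub>R n) n"
          using trans[OF in\<rho>[of y]] y(1,2) that by (intro mult_left_mono) auto
        with y(3) show ?thesis by simp
      qed
      from this[of 0 \<sigma>] this[of "-\<sigma>" 0] \<open>\<bar>\<phi> 0\<bar> \<le> \<sigma>\<close> \<open>\<sigma> > 0\<close>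
      have "\<phi> \<sigma> \<ge> 0" "\<phi> (-\<sigma>) \<le> 0" by auto
      moreover have "continuous_on {-\<sigma>..\<sigma>} \<phi>"
        by (rule DERIV_atLeastAtMost_imp_continuous_on[of _ _ _]) (use der in force)
      ultimately show ?thesis using IVT'[of \<phi> "-\<sigma>" 0 \<sigma>] \<open>\<sigma> > 0\<close> by auto
    qed
    then obtain s where "-\<sigma> \<le> s" "s \<le> \<sigma>" "\<phi> s = 0" by blast
    then have s: "\<bar>s\<bar> \<le> \<sigma>" "\<phi> s = 0" by auto
    have "z + v + s *\<^sub>R n \<in> frontier \<Omega>"
      using in\<rho>[OF s(1)] \<rho>U s(2) trans[OF in\<rho>[OF s(1)]]
      by (intro zero_in_frontier[OF op ldf, where n = n]) (auto simp: \<phi>_def)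
    with s(1) in\<rho>[OF s(1)] show ?thesis by (auto simp: \<sigma>_def)
  qed
  then have "smooth_boundary_point \<Omega> p U r n \<rho> \<delta> C"
    using op ldf \<rho>(1) \<rho>U \<delta>(1) \<delta>4(2) C(1) trans by unfold_locales auto
  then show ?thesis by (rule that)
qed

context smooth_boundary_point
begin

section \<open>Derivatives along the boundary\<close>

lemma open_U: "open U" and smooth_r: "smooth_on U r"
  using ldf by (auto simp: local_defining_function_def)

lemma r_zero: "z \<in> frontier \<Omega> \<Longrightarrow> z \<in> cball p \<rho> \<Longrightarrow> r z = 0"
  using defining_function_eq_zero[OF open_domain ldf] \<rho>(2) by auto

lemma in_U: "z \<in> cball p \<rho> \<Longrightarrow> z \<in> U"
  using \<rho>(2) by auto

lemma ball_subset_U: "ball p \<delta> \<subseteq> U"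
  using in_U \<delta>(2) by auto

text \<open>Taylor expansion of \<open>f\<close> along the corrected boundary step: the correction
  \<open>s\<close> is itself of second order in \<open>v\<close>, so it only enters the
  error.\<close>

lemma tangential_expansion:
  fixes f :: "complex ^ 'n \<Rightarrow> 'b::euclidean_space"
  assumes f: "smooth_on U f"
  obtains K where "K > 0" "\<And>z v. z \<in> frontier \<Omega> \<Longrightarrow> z \<in> cball p \<delta> \<Longrightarrow> norm v \<le> \<delta> \<Longrightarrow>
      frechet_derivative r (at z) v = 0 \<Longrightarrow>
      \<exists>q \<in> frontier \<Omega> \<inter> cball p \<rho>.
        norm (f q - f z - frechet_derivative f (at z) v) \<le> K * (norm v)\<^sup>2"
proof -
  let ?D = "\<lambda>x. frechet_derivative f (at x)"
  obtain A where A: "A > 0" "\<And>x y. x \<in> cball p \<rho> \<Longrightarrow> y \<in> cball p \<rho> \<Longrightarrow>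
      norm (f y - f x - ?D x (y - x)) \<le> A * (norm (y - x))\<^sup>2"
    using smooth_on_taylor2[OF f \<rho>(2)] by blast
  obtain B where B: "B > 0" "\<And>x. x \<in> cball p \<rho> \<Longrightarrow> norm (?D x n) \<le> B"
    using smooth_on_bounded_cball[OF smooth_on_frechet[OF f, of n] \<rho>(2)] by blast
  \<comment> \<open>The first summand comes from \<open>norm (v + s *\<^sub>R n) \<le> norm v * (1 +
    C * \<delta> * norm n)\<close> in the Taylor remainder, the second from the linear term
    \<open>s *\<^sub>R ?D z n\<close>.\<close>
  define K where "K = A * (1 + C * \<delta> * norm n)\<^sup>2 + C * B"
  have "K > 0" using A(1) B(1) C \<delta>(1) by (simp add: K_def add_nonneg_pos)
  moreover have "\<exists>q \<in> frontier \<Omega> \<inter> cball p \<rho>. norm (f q - f z - ?D z v) \<le> K * (norm v)\<^sup>2"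
    if z: "z \<in> frontier \<Omega>" "z \<in> cball p \<delta>" and v: "norm v \<le> \<delta>" "frechet_derivative r (at z) v = 0" for z v
  proof -
    obtain s where s: "\<bar>s\<bar> \<le> C * (norm v)\<^sup>2" "z + v + s *\<^sub>R n \<in> frontier \<Omega> \<inter> cball p \<rho>"
      using boundary_curve[OF z v] by blast
    let ?q = "z + v + s *\<^sub>R n"
    have z\<rho>: "z \<in> cball p \<rho>" using z(2) \<delta>(2) by simp
    have lin: "linear (?D z)"
      by (rule linear_frechet_derivative[OF smooth_on_differentiable[OF f in_U[OF z\<rho>]]])
    have eq: "f ?q - f z - ?D z v = (f ?q - f z - ?D z (?q - z)) + s *\<^sub>R ?D z n"
      by (simp add: linear_add[OF lin] linear_scale[OF lin])
    have "norm (v + s *\<^sub>R n) \<le> norm v + (C * (norm v)\<^sup>2) * norm n"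
      using norm_triangle_ineq[of v "s *\<^sub>R n"] mult_right_mono[OF s(1), of "norm n"] by simp
    also have "\<dots> = norm v * (1 + C * norm v * norm n)" by (simp add: power2_eq_square algebra_simps)
    also have "\<dots> \<le> norm v * (1 + C * \<delta> * norm n)"
      using v(1) C by (intro mult_left_mono add_left_mono mult_right_mono) auto
    finally have "(norm (v + s *\<^sub>R n))\<^sup>2 \<le> (norm v * (1 + C * \<delta> * norm n))\<^sup>2"
      by (intro power_mono) auto
    then have 1: "A * (norm (v + s *\<^sub>R n))\<^sup>2 \<le> A * ((norm v)\<^sup>2 * (1 + C * \<delta> * norm n)\<^sup>2)"
      using A(1) by (simp add: power_mult_distrib)
    have 2: "\<bar>s\<bar> * norm (?D z n) \<le> (C * (norm v)\<^sup>2) * B"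
      using s(1) B(2)[OF z\<rho>] C by (intro mult_mono) auto
    have "norm (f ?q - f z - ?D z v) \<le> norm (f ?q - f z - ?D z (?q - z)) + norm (s *\<^sub>R ?D z n)"
      unfolding eq by (rule norm_triangle_ineq)
    also have "\<dots> \<le> A * (norm (?q - z))\<^sup>2 + \<bar>s\<bar> * norm (?D z n)"
      using A(2)[OF z\<rho>, of ?q] s(2) by simp
    also have "\<dots> \<le> K * (norm v)\<^sup>2"
      using 1 2 by (simp add: K_def algebra_simps)
    finally show ?thesis using s(2) by blast
  qed
  ultimately show ?thesis by (rule that)
qed

text \<open>With \<open>f\<close> zero on the boundary, the expansion for the step
  \<open>t *\<^sub>R v\<close> makes a quantity linear in \<open>t\<close> bounded by a multiple of
  \<open>t\<^sup>2\<close>, which fails for small \<open>t\<close> unless the derivative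
  vanishes.\<close>

lemma tangential_derivative_zero:
  fixes f :: "complex ^ 'n \<Rightarrow> 'b::euclidean_space"
  assumes f: "smooth_on U f" and f0: "\<And>q. q \<in> frontier \<Omega> \<Longrightarrow> q \<in> cball p \<rho> \<Longrightarrow> f q = 0"
    and z: "z \<in> frontier \<Omega>" "z \<in> cball p \<delta>" and v: "frechet_derivative r (at z) v = 0"
  shows "frechet_derivative f (at z) v = 0"
proof (rule ccontr)
  let ?D = "frechet_derivative f (at z)"
  assume nz: "?D v \<noteq> 0"
  have z\<rho>: "z \<in> cball p \<rho>" using z(2) \<delta>(2) by simp
  have lin: "linear ?D" "linear (frechet_derivative r (at z))"
    using linear_frechet_derivative[OF smooth_on_differentiable[OF f in_U[OF z\<rho>]]]
      linear_frechet_derivative[OF smooth_on_differentiable[OF smooth_r in_U[OF z\<rho>]]] by auto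
  then have v0: "norm v > 0" using nz linear_0[OF lin(1)] by auto
  obtain K where K: "K > 0" "\<And>z v. z \<in> frontier \<Omega> \<Longrightarrow> z \<in> cball p \<delta> \<Longrightarrow> norm v \<le> \<delta> \<Longrightarrow>
      frechet_derivative r (at z) v = 0 \<Longrightarrow>
      \<exists>q \<in> frontier \<Omega> \<inter> cball p \<rho>. norm (f q - f z - frechet_derivative f (at z) v) \<le> K * (norm v)\<^sup>2"
    using tangential_expansion[OF f] by blast
  \<comment> \<open>The first entry makes the step admissible; the second makes the quadratic error
    at most half of the linear term.\<close>
  define t where "t = min (\<delta> / norm v) (norm (?D v) / (2 * K * (norm v)\<^sup>2))"
  have t: "t > 0" using \<delta>(1) v0 nz K(1) by (simp add: t_def)
  have "t * norm v \<le> \<delta>" using v0 by (subst pos_le_divide_eq[symmetric]) (auto simp: t_def)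
  then obtain q where "q \<in> frontier \<Omega> \<inter> cball p \<rho>" "norm (f q - f z - ?D (t *\<^sub>R v)) \<le> K * (norm (t *\<^sub>R v))\<^sup>2"
    using K(2)[OF z, of "t *\<^sub>R v"] t v by (auto simp: linear_scale[OF lin(2)])
  then have "t * norm (?D v) \<le> K * (t * norm v)\<^sup>2"
    using f0 z(1) z\<rho> t by (simp add: linear_scale[OF lin(1)])
  then have "norm (?D v) \<le> t * (K * (norm v)\<^sup>2)"
    using t by (simp add: power2_eq_square mult_ac)
  also have "\<dots> \<le> norm (?D v) / 2"
  proof -
    have "K * (norm v)\<^sup>2 > 0" using K(1) v0 by simp
    moreover have "t \<le> (norm (?D v) / 2) / (K * (norm v)\<^sup>2)" by (simp add: t_def mult_ac)
    ultimately show ?thesis by (subst pos_le_divide_eq[symmetric]) auto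
  qed
  finally show False using nz by simp
qed

text \<open>For real \<open>r\<close> the two real derivatives are, up to sign and a factor 2, the
  real and imaginary parts of the single complex equation.\<close>

lemma tangential_real_imag:
  assumes "z \<in> U" "vf_apply L (\<lambda>w. of_real (r w)) z = 0"
  shows "frechet_derivative r (at z) (L z) = 0" "frechet_derivative r (at z) (\<i> *s L z) = 0"
proof -
  have d: "r differentiable (at z)" by (rule smooth_on_differentiable[OF smooth_r assms(1)])
  have "(\<lambda>w. complex_of_real (r w)) differentiable (at z)"
    by (rule smooth_on_differentiable[OF smooth_on_of_real[OF open_U smooth_r] assms(1)])
  from vf_apply_frechet(1)[OF this, of L] assms(2)
  show "frechet_derivative r (at z) (L z) = 0" "frechet_derivative r (at z) (\<i> *s L z) = 0"
    by (simp_all add: frechet_of_real[OF d] complex_eq_iff)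
qed

lemma tangential_apply_zero:
  assumes f: "smooth_on U f" "\<And>q. q \<in> frontier \<Omega> \<Longrightarrow> q \<in> cball p \<rho> \<Longrightarrow> f q = 0"
    and z: "z \<in> frontier \<Omega>" "z \<in> cball p \<delta>" and L: "vf_apply L (\<lambda>w. of_real (r w)) z = 0"
  shows "vf_apply L f z = 0"
proof -
  have "z \<in> U" using in_U[of z] z(2) \<delta>(2) by simp
  then show ?thesis
    using tangential_derivative_zero[OF f z] tangential_real_imag[OF _ L]
    by (simp add: vf_apply_frechet smooth_on_differentiable[OF f(1)])
qed

text \<open>The derivative of \<open>r'\<close> kills the kernel of that of \<open>r\<close>, hence
  is a multiple of it. The factor is nonzero because the derivative of \<open>r'\<close> is, and
  positive because a short inward segment lies in \<open>\<Omega>\<close>, where \<open>r'\<close>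
  is negative.\<close>

lemma defining_functions_proportional:
  assumes ldf': "local_defining_function \<Omega> p U r'" and z: "z \<in> frontier \<Omega>" "z \<in> cball p \<delta>"
  obtains h where "h > 0" "\<And>v. frechet_derivative r' (at z) v = h * frechet_derivative r (at z) v"
proof -
  let ?D = "frechet_derivative r (at z)" and ?D' = "frechet_derivative r' (at z)"
  have z\<rho>: "z \<in> cball p \<rho>" using z(2) \<delta>(2) by simp
  have r': "smooth_on U r'" using ldf' by (simp add: local_defining_function_def)
  have lin: "linear ?D" "linear ?D'"
    using smooth_on_differentiable[OF _ in_U[OF z\<rho>]] r' smooth_r
    by (auto intro!: linear_frechet_derivative)
  have n: "?D n \<ge> 1" by (rule transversal[OF z\<rho>])
  define h where "h = ?D' n / ?D n"
  have eq: "?D' v = h * ?D v" for v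
  proof -
    \<comment> \<open>Projection of \<open>v\<close> along \<open>n\<close> into the kernel of
      \<open>?D\<close>.\<close>
    let ?w = "v - (?D v / ?D n) *\<^sub>R n"
    have "?D ?w = 0" using n by (simp add: linear_diff[OF lin(1)] linear_scale[OF lin(1)])
    then have "?D' ?w = 0"
      by (intro tangential_derivative_zero[OF r' _ z])
        (rule defining_function_eq_zero[OF open_domain ldf' in_U])
    then show ?thesis by (simp add: linear_diff[OF lin(2)] linear_scale[OF lin(2)] h_def)
  qed
  have "?D' \<noteq> (\<lambda>v. 0)" using ldf' z(1) in_U[OF z\<rho>] by (auto simp: local_defining_function_def)
  then have "h \<noteq> 0" using eq by auto
  moreover have "\<not> h < 0"
  proof
    assume "h < 0"
    have r0: "r z = 0" "r' z = 0"
      using defining_function_eq_zero[OF open_domain _ in_U[OF z\<rho>] z(1)] ldf ldf' by auto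
    obtain d where d: "d > 0" "\<And>t. 0 < t \<Longrightarrow> t < d \<Longrightarrow> z + (- t) *\<^sub>R n \<in> \<Omega> \<inter> U"
      by (rule inward_segment_in_domain[OF ldf in_U[OF z\<rho>] r0(1), of n]) (use n in auto)
    have "((\<lambda>t. r' (z + t *\<^sub>R n)) has_real_derivative ?D' n) (at 0)"
      using has_real_derivative_along_line[of r' z 0 n] smooth_on_differentiable[OF r' in_U[OF z\<rho>]] by simp
    moreover have "?D' n < 0" unfolding eq[of n] using \<open>h < 0\<close> n by (simp add: mult_neg_pos)
    ultimately obtain e where e: "e > 0" "\<And>t. 0 < t \<Longrightarrow> t < e \<Longrightarrow> 0 < r' (z + (- t) *\<^sub>R n)"
      using DERIV_neg_dec_left[of "\<lambda>t. r' (z + t *\<^sub>R n)" "?D' n" 0] r0(2) by auto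
    define t where "t = min d e / 2"
    have t: "0 < t" "t < d" "t < e" using d(1) e(1) by (auto simp: t_def)
    have "z + (- t) *\<^sub>R n \<in> {z \<in> U. r' z < 0}"
      using d(2)[OF t(1,2)] ldf' unfolding local_defining_function_def by blast
    then show False using e(2)[OF t(1,3)] by simp
  qed
  ultimately show ?thesis using eq by (intro that[of h]) auto
qed

lemma dz_proportional:
  assumes ldf': "local_defining_function \<Omega> p U r'" and z: "z \<in> frontier \<Omega>" "z \<in> cball p \<delta>"
  obtains h :: real where "h > 0"
    "\<And>j. dz j (\<lambda>w. complex_of_real (r' w)) z = h * dz j (\<lambda>w. complex_of_real (r w)) z"
proof -
  have zU: "z \<in> U" using in_U[of z] z(2) \<delta>(2) by simp
  have r': "smooth_on U r'" using ldf' by (simp add: local_defining_function_def)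
  obtain h where h: "h > 0" "\<And>v. frechet_derivative r' (at z) v = h * frechet_derivative r (at z) v"
    using defining_functions_proportional[OF ldf' z] by blast
  have "dz j (\<lambda>w. complex_of_real (r' w)) z = h * dz j (\<lambda>w. complex_of_real (r w)) z" for j
    using smooth_on_differentiable[OF r' zU] smooth_on_differentiable[OF smooth_r zU]
    by (simp add: dz_def frechet_of_real h(2) field_simps)
  with h(1) show ?thesis by (rule that)
qed

lemma tangential_vf_transfer:
  assumes ldf': "local_defining_function \<Omega> p U r'" and L: "tangential_vf \<Omega> r U L"
  shows "tangential_vf \<Omega> r' (ball p \<delta>) L"
proof -
  have "vf_apply L (\<lambda>w. complex_of_real (r' w)) q = 0" if q: "q \<in> frontier \<Omega>" "q \<in> ball p \<delta>" for q
  proof -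
    have "q \<in> cball p \<delta>" using q(2) by simp
    from dz_proportional[OF ldf' q(1) this] obtain h :: real where
      "\<And>j. dz j (\<lambda>w. complex_of_real (r' w)) q = h * dz j (\<lambda>w. complex_of_real (r w)) q"
      by blast
    then have "vf_apply L (\<lambda>w. complex_of_real (r' w)) q = h * vf_apply L (\<lambda>w. complex_of_real (r w)) q"
      by (simp add: vf_apply_def sum_distrib_left mult_ac)
    then show ?thesis using L q ball_subset_U by (auto simp: tangential_vf_def)
  qed
  then show ?thesis using L smooth_on_subset[OF _ ball_subset_U] by (auto simp: tangential_vf_def)
qed

text \<open>By \<open>complex_hessian_eq_first_order\<close> both Levi forms depend on their
  defining function only through its first derivatives, and these are proportional at
  \<open>z\<close>.\<close>

lemma levi_proportional:
  assumes ldf': "local_defining_function \<Omega> p U r'"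
    and L: "tangential_vf \<Omega> r U L" "tangential_vf \<Omega> r' U L"
    and z: "z \<in> frontier \<Omega>" "z \<in> cball p \<delta>"
  obtains h where "h > 0" "levi r' L z = h * levi r L z"
proof -
  have r': "smooth_on U r'" using ldf' by (simp add: local_defining_function_def)
  have sL: "smooth_on U L" using L(1) by (simp add: tangential_vf_def)
  have zU: "z \<in> U" using in_U[of z] z(2) \<delta>(2) by simp
  obtain h :: real where h: "h > 0"
    "\<And>j. dz j (\<lambda>w. complex_of_real (r' w)) z = h * dz j (\<lambda>w. complex_of_real (r w)) z"
    using dz_proportional[OF ldf' z] by blast
  \<comment> \<open>The conjugate of \<open>L g\<close> vanishes on the boundary, hence so does its
    derivative in the tangential direction \<open>L\<close>.\<close>
  have zero: "vf_apply L (\<lambda>w. cnj (vf_apply L (\<lambda>w. complex_of_real (g w)) w)) z = 0"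
    if g: "smooth_on U g" "tangential_vf \<Omega> g U L" for g
  proof (rule tangential_apply_zero[OF _ _ z])
    show "smooth_on U (\<lambda>w. cnj (vf_apply L (\<lambda>w. complex_of_real (g w)) w))"
      by (intro smooth_intros open_U g sL)
    show "cnj (vf_apply L (\<lambda>w. complex_of_real (g w)) q) = 0"
      if "q \<in> frontier \<Omega>" "q \<in> cball p \<rho>" for q
      using g(2) that in_U[of q] by (simp add: tangential_vf_def)
    show "vf_apply L (\<lambda>w. complex_of_real (r w)) z = 0"
      using L(1) z(1) zU by (simp add: tangential_vf_def)
  qed
  have "complex_hessian r' L L z = of_real h * complex_hessian r L L z"
    using complex_hessian_eq_first_order[OF open_U zU r' sL zero[OF r' L(2)]]
      complex_hessian_eq_first_order[OF open_U zU smooth_r sL zero[OF smooth_r L(1)]]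
    by (simp add: h(2) sum_distrib_left mult_ac)
  then have "levi r' L z = h * levi r L z" by (simp add: levi_def)
  with h(1) show ?thesis by (rule that)
qed

text \<open>Move from \<open>z\<close> along the boundary by a small multiple of the tangential gradient of \<open>f\<close>.\<close>

lemma tangential_gradient_estimate:
  assumes f: "smooth_on U f" "\<And>q. q \<in> frontier \<Omega> \<Longrightarrow> q \<in> cball p \<rho> \<Longrightarrow> 0 \<le> (f q :: real)"
    and L: "tangential_vf \<Omega> r U L"
  obtains M where "M > 0" "\<And>z. z \<in> frontier \<Omega> \<Longrightarrow> z \<in> cball p \<delta> \<Longrightarrow>
    (cmod (vf_apply L (\<lambda>w. of_real (f w)) z))\<^sup>2 \<le> M * f z"
proof -
  let ?f = "\<lambda>w. complex_of_real (f w)" and ?D = "\<lambda>z. frechet_derivative f (at z)"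
  have sL: "smooth_on U L" and tan: "\<And>q. q \<in> frontier \<Omega> \<Longrightarrow> q \<in> U \<Longrightarrow> vf_apply L (\<lambda>w. of_real (r w)) q = 0"
    using L by (auto simp: tangential_vf_def)
  have sf: "smooth_on U ?f" by (intro smooth_intros open_U f(1))
  obtain K where K: "K > 0" "\<And>z v. z \<in> frontier \<Omega> \<Longrightarrow> z \<in> cball p \<delta> \<Longrightarrow> norm v \<le> \<delta> \<Longrightarrow>
      frechet_derivative r (at z) v = 0 \<Longrightarrow>
      \<exists>q \<in> frontier \<Omega> \<inter> cball p \<rho>. norm (f q - f z - frechet_derivative f (at z) v) \<le> K * (norm v)\<^sup>2"
    using tangential_expansion[OF f(1)] by blast
  obtain X where X: "X > 0" "\<And>z. z \<in> cball p \<rho> \<Longrightarrow> cmod (vf_apply L ?f z) \<le> X"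
    using smooth_on_bounded_cball[OF smooth_on_vf_apply(1)[OF open_U sL sf] \<rho>(2)] by blast
  obtain R where R: "R > 0" "\<And>z. z \<in> cball p \<rho> \<Longrightarrow> norm (L z) \<le> R"
    using smooth_on_bounded_cball[OF sL \<rho>(2)] by blast
  \<comment> \<open>The first entry makes the quadratic error at most half of the decrease
    \<open>\<epsilon> * x\<^sup>2\<close>; the second keeps the step within \<open>\<delta>\<close>,
    as its length is at most \<open>\<epsilon> * (2 * X * R)\<close>.\<close>
  define \<epsilon> where "\<epsilon> = min (1 / (2 * K * R\<^sup>2)) (\<delta> / (2 * X * R))"
  have \<epsilon>: "\<epsilon> > 0" using K(1) X(1) R(1) \<delta>(1) by (simp add: \<epsilon>_def)
  have \<epsilon>1: "\<epsilon> * (2 * K * R\<^sup>2) \<le> 1" and \<epsilon>2: "\<epsilon> * (2 * X * R) \<le> \<delta>"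
    using K(1) X(1) R(1) by (subst pos_le_divide_eq[symmetric], simp, simp add: \<epsilon>_def)+
  have "(cmod (vf_apply L ?f z))\<^sup>2 \<le> (1 / \<epsilon>) * f z" if z: "z \<in> frontier \<Omega>" "z \<in> cball p \<delta>" for z
  proof -
    have z\<rho>: "z \<in> cball p \<rho>" using z(2) \<delta>(2) by simp
    note zU = in_U[OF z\<rho>]
    have lin: "linear (?D z)" "linear (frechet_derivative r (at z))"
      using smooth_on_differentiable[OF _ zU] f(1) smooth_r by (auto intro!: linear_frechet_derivative)
    \<comment> \<open>Stated for a real tangent direction, to be used with both \<open>L z\<close>
      and \<open>\<i> *s L z\<close>.\<close>
    have est: "(?D z w)\<^sup>2 \<le> (2 / \<epsilon>) * f z"
      if w: "norm w \<le> R" "\<bar>?D z w\<bar> \<le> 2 * X" "frechet_derivative r (at z) w = 0" for w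
    proof -
      define x where "x = ?D z w"
      define v where "v = (- (\<epsilon> * x)) *\<^sub>R w"
      have "norm v = \<epsilon> * (\<bar>x\<bar> * norm w)" using \<epsilon> by (simp add: v_def abs_mult)
      also have "\<dots> \<le> \<epsilon> * (2 * X * R)" using w \<epsilon> X(1) unfolding x_def by (intro mult_left_mono mult_mono) auto
      finally have v\<delta>: "norm v \<le> \<delta>" using \<epsilon>2 by simp
      have "frechet_derivative r (at z) v = 0" using w(3) by (simp add: v_def linear_scale[OF lin(2)] linear_neg[OF lin(2)])
      from K(2)[OF z v\<delta> this] obtain q where q: "q \<in> frontier \<Omega>" "q \<in> cball p \<rho>"
        "\<bar>f q - f z - ?D z v\<bar> \<le> K * (norm v)\<^sup>2" by auto
      have "?D z v = - \<epsilon> * x\<^sup>2" by (simp add: v_def linear_scale[OF lin(1)] linear_neg[OF lin(1)] x_def power2_eq_square)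
      moreover have "K * (norm v)\<^sup>2 \<le> \<epsilon> * x\<^sup>2 / 2"
      proof -
        have "(norm v)\<^sup>2 \<le> (\<epsilon> * \<bar>x\<bar> * R)\<^sup>2"
          using w(1) \<epsilon> by (intro power_mono) (auto simp: v_def abs_mult intro!: mult_left_mono)
        then have "K * (norm v)\<^sup>2 \<le> K * (\<epsilon> * \<bar>x\<bar> * R)\<^sup>2" using K(1) by simp
        also have "\<dots> = (\<epsilon> * (2 * K * R\<^sup>2)) * (\<epsilon> * x\<^sup>2 / 2)" by (simp add: power_mult_distrib power2_eq_square)
        also have "\<dots> \<le> 1 * (\<epsilon> * x\<^sup>2 / 2)" using \<epsilon>1 \<epsilon> by (intro mult_right_mono) auto
        finally show ?thesis by simp
      qed
      ultimately have "0 \<le> f z - \<epsilon> * x\<^sup>2 / 2" using q(3) f(2)[OF q(1,2)] by linarith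
      then show ?thesis using \<epsilon> by (simp add: x_def field_simps)
    qed
    let ?a = "?D z (L z)" and ?b = "?D z (\<i> *s L z)"
    have vf: "vf_apply L ?f z = (of_real ?a - \<i> * of_real ?b) / 2"
      using vf_apply_frechet(1)[OF smooth_on_differentiable[OF sf zU], of L]
      by (simp add: frechet_of_real[OF smooth_on_differentiable[OF f(1) zU]])
    have "\<bar>?a\<bar> \<le> 2 * X" "\<bar>?b\<bar> \<le> 2 * X"
      using abs_Re_le_cmod[of "vf_apply L ?f z"] abs_Im_le_cmod[of "vf_apply L ?f z"] X(2)[OF z\<rho>]
      unfolding vf by auto
    moreover have "norm (\<i> *s L z) = norm (L z)" by (simp add: norm_vec_def norm_mult)
    ultimately have "?a\<^sup>2 \<le> (2 / \<epsilon>) * f z" "?b\<^sup>2 \<le> (2 / \<epsilon>) * f z"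
      using est R(2)[OF z\<rho>] tangential_real_imag[OF zU tan[OF z(1) zU]] by auto
    moreover have "(cmod (vf_apply L ?f z))\<^sup>2 = (?a\<^sup>2 + ?b\<^sup>2) / 4"
      unfolding vf by (simp add: cmod_power2 power_divide add_divide_distrib)
    ultimately show ?thesis by (simp add: field_simps)
  qed
  with \<epsilon> show ?thesis by (intro that[of "1 / \<epsilon>"]) auto
qed

end

text \<open>Pseudoconvexity speaks of some defining function \<open>r'\<close> and of fields
  tangential for it. Near \<open>p\<close> the given \<open>L\<close> is tangential for
  \<open>r'\<close> as well, and the two Levi forms differ by a positive factor.\<close>

lemma levi_nonneg_of_pseudoconvex_at:
  assumes "open \<Omega>" and ldf: "local_defining_function \<Omega> p U r"
    and L: "tangential_vf \<Omega> r U L" and psc: "pseudoconvex_at \<Omega> p"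
  obtains W where "open W" "p \<in> W" "W \<subseteq> U" "\<And>z. z \<in> frontier \<Omega> \<Longrightarrow> z \<in> W \<Longrightarrow> 0 \<le> levi r L z"
proof -
  obtain U' r' where p: "p \<in> frontier \<Omega>" and ldf': "local_defining_function \<Omega> p U' r'"
    and H: "\<forall>V L. open V \<and> p \<in> V \<and> V \<subseteq> U' \<and> tangential_vf \<Omega> r' V L \<longrightarrow>
           (\<forall>z \<in> frontier \<Omega> \<inter> V. 0 \<le> levi r' L z)"
    using psc unfolding pseudoconvex_at_def by (elim conjE exE)
  have restrict: "tangential_vf \<Omega> s B L" if "tangential_vf \<Omega> s A L" "B \<subseteq> A" for s A B
  proof -
    have "smooth_on B L"
      using that by (intro smooth_on_subset[of A L B]) (simp_all add: tangential_vf_def)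
    then show ?thesis using that by (auto simp: tangential_vf_def)
  qed
  have opU: "open U" "open U'" "p \<in> U" "p \<in> U'"
    using ldf ldf' by (auto simp: local_defining_function_def)
  let ?W1 = "U \<inter> U'"
  have W1: "open ?W1" "p \<in> ?W1" using opU by auto
  have l1: "local_defining_function \<Omega> p ?W1 r" "local_defining_function \<Omega> p ?W1 r'"
    using local_defining_function_subset[OF ldf W1] local_defining_function_subset[OF ldf' W1] by auto
  obtain n1 \<rho>1 \<delta>1 C1 where sbp1: "smooth_boundary_point \<Omega> p ?W1 r n1 \<rho>1 \<delta>1 C1"
    using smooth_boundary_point_exists[OF assms(1) l1(1) p] by blast
  let ?W2 = "ball p \<delta>1"
  have W2: "open ?W2" "p \<in> ?W2" "?W2 \<subseteq> ?W1"
    using smooth_boundary_point.\<delta>[OF sbp1] smooth_boundary_point.ball_subset_U[OF sbp1] by auto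
  have l2: "local_defining_function \<Omega> p ?W2 r" "local_defining_function \<Omega> p ?W2 r'"
    using local_defining_function_subset[OF l1(1) W2] local_defining_function_subset[OF l1(2) W2] by auto
  have L2: "tangential_vf \<Omega> r ?W2 L" "tangential_vf \<Omega> r' ?W2 L"
    using W2(3) smooth_boundary_point.tangential_vf_transfer[OF sbp1 l1(2) restrict[OF L]]
    by (intro restrict[OF L], simp_all)
  \<comment> \<open>A second shrinking: \<open>levi_proportional\<close> asks for tangency with
    respect to \<open>r'\<close> on the whole neighbourhood, which is known only on the first
    ball.\<close>
  obtain n2 \<rho>2 \<delta>2 C2 where sbp2: "smooth_boundary_point \<Omega> p ?W2 r n2 \<rho>2 \<delta>2 C2"
    using smooth_boundary_point_exists[OF assms(1) l2(1) p] by blast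
  have sub: "ball p \<delta>2 \<subseteq> ?W2"
    by (rule smooth_boundary_point.ball_subset_U[OF sbp2])
  show ?thesis
  proof
    show "open (ball p \<delta>2)" "p \<in> ball p \<delta>2" using smooth_boundary_point.\<delta>[OF sbp2] by auto
    show "ball p \<delta>2 \<subseteq> U" using sub W2(3) by blast
    fix z assume z: "z \<in> frontier \<Omega>" "z \<in> ball p \<delta>2"
    have "z \<in> cball p \<delta>2" using z(2) by simp
    from smooth_boundary_point.levi_proportional[OF sbp2 l2(2) L2 z(1) this]
    obtain h where "h > 0" "levi r' L z = h * levi r L z" by blast
    moreover have "0 \<le> levi r' L z"
      using H[rule_format, of ?W2 L z] W2 L2(2) z sub by auto
    ultimately show "0 \<le> levi r L z" by (simp add: zero_le_mult_iff)
  qed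
qed

section \<open>Construction of the defining function\<close>

text \<open>In dimension two the vectors annihilated by a nonzero row \<open>r\<close> form a line,
  spanned by \<open>l\<close>. Subtracting from \<open>v\<close> its orthogonal projection onto the
  conjugate of \<open>r\<close> lands in that line.\<close>

lemma complex_2_decomposition:
  fixes l r v :: "complex ^ 2"
  assumes "l \<noteq> 0" and "l $ 1 * r $ 1 + l $ 2 * r $ 2 = 0" and "r \<noteq> 0"
  obtains a b where "v = a *s l + b *s (\<chi> j. cnj (r $ j))"
proof -
  define \<nu> where "\<nu> = r $ 1 * cnj (r $ 1) + r $ 2 * cnj (r $ 2)"
  have "\<nu> = of_real ((cmod (r $ 1))\<^sup>2 + (cmod (r $ 2))\<^sup>2)"
    unfolding \<nu>_def of_real_add by (simp only: complex_norm_square)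
  then have \<nu>: "\<nu> \<noteq> 0"
    using assms(3) by (auto simp: vec_eq_iff forall_2 add_nonneg_eq_0_iff simp del: of_real_add of_real_power)
  define b where "b = (v $ 1 * r $ 1 + v $ 2 * r $ 2) / \<nu>"
  define w where "w = v - b *s (\<chi> j. cnj (r $ j))"
  have "b * \<nu> = v $ 1 * r $ 1 + v $ 2 * r $ 2" using \<nu> by (simp add: b_def)
  then have w: "w $ 1 * r $ 1 + w $ 2 * r $ 2 = 0"
    by (simp add: w_def \<nu>_def algebra_simps)
  have l: "l $ 1 \<noteq> 0 \<or> l $ 2 \<noteq> 0" and r: "r $ 1 \<noteq> 0 \<or> r $ 2 \<noteq> 0"
    using assms(1,3) by (auto simp: vec_eq_iff forall_2)
  \<comment> \<open>Both \<open>w\<close> and \<open>l\<close> are annihilated by the nonzero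
    \<open>r\<close>, so their determinant vanishes.\<close>
  have det: "w $ 1 * l $ 2 = w $ 2 * l $ 1"
  proof -
    have "r $ 1 * (w $ 1 * l $ 2 - w $ 2 * l $ 1) = 0" "r $ 2 * (w $ 1 * l $ 2 - w $ 2 * l $ 1) = 0"
      using w assms(2) by algebra+
    then show ?thesis using r by auto
  qed
  have "\<exists>a. w = a *s l"
  proof (cases "l $ 1 = 0")
    case True
    then show ?thesis using l det
      by (intro exI[of _ "w $ 2 / l $ 2"]) (auto simp: vec_eq_iff forall_2)
  next
    case False
    then show ?thesis using det
      by (intro exI[of _ "w $ 1 / l $ 1"]) (auto simp: vec_eq_iff forall_2 field_simps)
  qed
  then obtain a where "w = a *s l" by blast
  then have "v = a *s l + b *s (\<chi> j. cnj (r $ j))" by (simp add: w_def algebra_simps)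
  then show ?thesis by (rule that)
qed

text \<open>After multiplication by \<open>c\<close> the mixed term is absorbed by the inequality
  between \<open>2 * x * y\<close> and the sum of squares, with \<open>x = cmod a * cmod F\<close>
  and \<open>y = c * cmod b\<close>.\<close>

lemma hermitian_form_nonneg:
  fixes a b F :: complex
  assumes "0 < c" "(cmod F)\<^sup>2 \<le> c * m" "c \<le> \<kappa>"
  shows "0 \<le> (cmod a)\<^sup>2 * m + 2 * Re (a * cnj b * F) + (cmod b)\<^sup>2 * \<kappa>"
proof -
  let ?x = "cmod a * cmod F" and ?y = "cmod b"
  have "- (?x * ?y) \<le> Re (a * cnj b * F)"
    using abs_Re_le_cmod[of "a * cnj b * F"] by (simp add: norm_mult mult_ac abs_le_iff)
  moreover have "c * (2 * (?x * ?y)) \<le> ?x\<^sup>2 + (c * ?y)\<^sup>2"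
    using sum_squares_bound[of ?x "c * ?y"] by (simp add: mult_ac)
  moreover have "?x\<^sup>2 \<le> c * ((cmod a)\<^sup>2 * m)"
    using mult_left_mono[OF assms(2), of "(cmod a)\<^sup>2"] by (simp add: power_mult_distrib mult_ac)
  moreover have "(c * ?y)\<^sup>2 \<le> c * (?y\<^sup>2 * \<kappa>)"
    using mult_left_mono[OF assms(3), of "c * ?y\<^sup>2"] assms(1) by (simp add: power_mult_distrib power2_eq_square mult_ac)
  ultimately have "c * (2 * (?x * ?y)) \<le> c * ((cmod a)\<^sup>2 * m + ?y\<^sup>2 * \<kappa>)"
    by (simp add: algebra_simps)
  then have "2 * (?x * ?y) \<le> (cmod a)\<^sup>2 * m + ?y\<^sup>2 * \<kappa>" using assms(1) by simp
  with \<open>- (?x * ?y) \<le> Re (a * cnj b * F)\<close> show ?thesis by linarith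
qed

section \<open>Multiplying a defining function by a positive factor\<close>

lemma vf_apply_combination:
  assumes "V p = a *s A p + b *s B p"
  shows "vf_apply V f p = a * vf_apply A f p + b * vf_apply B f p"
  by (simp add: vf_apply_def assms sum_distrib_left sum.distrib[symmetric] algebra_simps)

lemma local_defining_function_mult:
  assumes "open \<Omega>" and ldf: "local_defining_function \<Omega> p U r" and h: "smooth_on U h" "\<And>z. z \<in> U \<Longrightarrow> 0 < h z"
  shows "local_defining_function \<Omega> p U (\<lambda>z. r z * h z)"
proof -
  have U: "open U" "p \<in> U" "smooth_on U r" "\<Omega> \<inter> U = {z \<in> U. r z < 0}"
    "\<forall>z \<in> frontier \<Omega> \<inter> U. frechet_derivative r (at z) \<noteq> (\<lambda>v. 0)"
    using ldf by (auto simp: local_defining_function_def)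
  have "frechet_derivative (\<lambda>z. r z * h z) (at z) \<noteq> (\<lambda>v. 0)" if z: "z \<in> frontier \<Omega> \<inter> U" for z
  proof -
    have "frechet_derivative (\<lambda>z. r z * h z) (at z)
        = (\<lambda>v. r z * frechet_derivative h (at z) v + frechet_derivative r (at z) v * h z)"
      by (rule frechet_derivative_eqI, rule has_derivative_mult)
        (use z U(3) h(1) in \<open>auto intro: smooth_on_has_derivative\<close>)
    moreover have "r z = 0" using defining_function_eq_zero[OF assms(1) ldf] z by auto
    moreover have "h z \<noteq> 0" using h(2)[of z] z by auto
    ultimately show ?thesis using U(5) z by (auto simp: fun_eq_iff)
  qed
  moreover have "smooth_on U (\<lambda>z. r z * h z)" by (intro smooth_intros U h)
  moreover have "{z \<in> U. r z * h z < 0} = {z \<in> U. r z < 0}"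
    using h(2) by (auto simp: mult_less_0_iff dest: less_asym)
  ultimately show ?thesis using U unfolding local_defining_function_def by auto
qed

text \<open>For \<open>A = B = V\<close> the two mixed terms of
  \<open>complex_hessian_mult_at_zero\<close> are conjugate to each other, so they add up to twice a
  real part.\<close>

lemma levi_mult_exp:
  assumes S: "open S" "p \<in> S" and r: "smooth_on S r" and g: "smooth_on S g" and r0: "r p = 0"
  shows "levi (\<lambda>z. r z * exp (g z)) V p = exp (g p) * (levi r V p
    + 2 * Re (vf_apply V (\<lambda>z. of_real (g z)) p * cnj (vf_apply V (\<lambda>z. of_real (r z)) p)))"
proof -
  have "vf_apply V (\<lambda>z. of_real (exp (g z))) p = of_real (exp (g p)) * vf_apply V (\<lambda>z. of_real (g z)) p"
    unfolding vf_apply_def dz_exp[OF smooth_on_differentiable[OF g S(2)]]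
    by (simp add: sum_distrib_left mult_ac)
  then show ?thesis
    unfolding levi_def
      complex_hessian_mult_at_zero[OF S r smooth_on_exp[OF S(1) g] r0]
    by (simp add: algebra_simps)
qed

text \<open>Applying \<open>L\<close> to \<open>g\<close> gives
  \<open>\<gamma> A + cnj \<gamma> B\<close> when it hits \<open>\<mu>\<close> or its conjugate, and
  terms of size \<open>|\<mu>|\<close> when it hits \<open>\<gamma>\<close>. So
  \<open>\<gamma>\<close> is chosen to cancel \<open>E\<close> against the former, and only the
  latter remain.\<close>

lemma (in smooth_boundary_point) exists_correction:
  fixes L :: "complex ^ 'n \<Rightarrow> complex ^ 'n" and lam :: "complex ^ 'n \<Rightarrow> real"
    and E :: "complex ^ 'n \<Rightarrow> complex" and \<nu> :: "complex ^ 'n \<Rightarrow> real"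
  defines "lamc \<equiv> \<lambda>z. complex_of_real (lam z)"
  assumes L: "smooth_on U L" and lam: "smooth_on U lam" and E: "smooth_on U E"
    and \<nu>: "smooth_on U \<nu>" "\<And>z. z \<in> U \<Longrightarrow> 0 < \<nu> z"
    and strict: "\<And>z. z \<in> U \<Longrightarrow> cmod (vf_apply L (vf_apply L lamc) z) < cmod (vf_apply L (vf_conj_apply L lamc) z)"
  obtains g C1 where "smooth_on U g" "C1 > 0"
    "\<And>z. z \<in> cball p \<rho> \<Longrightarrow>
      cmod (E z + \<nu> z * vf_apply L (\<lambda>w. of_real (g w)) z) \<le> C1 * cmod (vf_apply L lamc z)"
proof -
  define \<mu> A B where "\<mu> = vf_conj_apply L lamc" and "A = vf_apply L \<mu>" and "B = vf_apply L (vf_apply L lamc)"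
  have slamc: "smooth_on U lamc" unfolding lamc_def by (intro smooth_intros open_U lam)
  have s\<mu>: "smooth_on U \<mu>" and sA: "smooth_on U A" and sB: "smooth_on U B"
    unfolding \<mu>_def A_def B_def by (intro smooth_intros open_U L slamc)+
  \<comment> \<open>Inverse of \<open>\<nu>\<close> times the determinant
    \<open>|A|\<^sup>2 - |B|\<^sup>2\<close> of the real-linear map
    \<open>\<gamma> \<mapsto> \<gamma> A + cnj \<gamma> B\<close>. Squared moduli are written as
    real parts of products to fit the closure rules for smooth maps.\<close>
  define q where "q z = inverse (\<nu> z * (Re (A z * cnj (A z)) - Re (B z * cnj (B z))))" for z
  have gap: "(cmod (B z))\<^sup>2 < (cmod (A z))\<^sup>2" if "z \<in> U" for z
    using strict[OF that] by (auto simp: A_def B_def \<mu>_def intro!: power_strict_mono)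
  have absq: "Re (w * cnj w) = (cmod w)\<^sup>2" for w
    by (simp add: complex_mult_cnj cmod_power2)
  have ofq: "of_real (Re (w * cnj w)) = w * cnj w" for w
    by (simp add: complex_eq_iff)
  have q0: "\<nu> z * (Re (A z * cnj (A z)) - Re (B z * cnj (B z))) \<noteq> 0" if "z \<in> U" for z
    using gap[OF that] \<nu>(2)[OF that] unfolding absq by auto
  have sq: "smooth_on U q"
    unfolding q_def[abs_def] using q0 by (intro smooth_intros open_U \<nu>(1) sA sB)
  \<comment> \<open>Cramer's rule for the equation together with its conjugate.\<close>
  define \<gamma> where "\<gamma> z = of_real (q z) * (cnj (E z) * B z - E z * cnj (A z))" for z
  have s\<gamma>: "smooth_on U \<gamma>" unfolding \<gamma>_def[abs_def] by (intro smooth_intros open_U sq E sA sB)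
  have solve: "E z + \<nu> z * (\<gamma> z * A z + cnj (\<gamma> z) * B z) = 0" if "z \<in> U" for z
  proof -
    let ?d = "A z * cnj (A z) - B z * cnj (B z)"
    have "of_real (\<nu> z * (Re (A z * cnj (A z)) - Re (B z * cnj (B z)))) = of_real (\<nu> z) * ?d"
      by (simp only: of_real_mult of_real_diff ofq)
    then have "of_real (\<nu> z) * of_real (q z) * ?d = 1"
      using q0[OF that] unfolding q_def
      by (metis mult.assoc mult.commute of_real_1 of_real_mult right_inverse)
    moreover have "\<gamma> z * A z + cnj (\<gamma> z) * B z = - (E z * (of_real (q z) * ?d))"
      by (simp add: \<gamma>_def algebra_simps)
    ultimately show ?thesis by (simp add: mult_ac)
  qed
  define g where "g z = 2 * Re (\<gamma> z * \<mu> z)" for z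
  have sg: "smooth_on U g" unfolding g_def[abs_def] by (intro smooth_intros open_U s\<gamma> s\<mu>)
  define H where "H z = vf_apply L \<gamma> z" for z
  define H' where "H' z = vf_apply L (\<lambda>w. cnj (\<gamma> w)) z" for z
  have sH: "smooth_on U H" "smooth_on U H'"
    unfolding H_def[abs_def] H'_def[abs_def] by (intro smooth_intros open_U L s\<gamma>)+
  have cnj\<mu>: "cnj (\<mu> z) = vf_apply L lamc z" if "z \<in> U" for z
    using vf_conj_apply_of_real[OF smooth_on_differentiable[OF lam that], of L]
    by (simp add: \<mu>_def lamc_def)
  have Lg: "vf_apply L (\<lambda>w. of_real (g w)) z = \<gamma> z * A z + H z * \<mu> z + (cnj (\<gamma> z) * B z + H' z * cnj (\<mu> z))"
    if z: "z \<in> U" for z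
  proof -
    have d: "\<gamma> differentiable (at z)" "\<mu> differentiable (at z)" "(\<lambda>w. cnj (\<gamma> w)) differentiable (at z)"
      "(\<lambda>w. cnj (\<mu> w)) differentiable (at z)"
      by (rule smooth_on_differentiable[OF _ z], intro smooth_intros open_U s\<gamma> s\<mu>)+
    have "(\<lambda>w. of_real (g w)) = (\<lambda>w. \<gamma> w * \<mu> w + cnj (\<gamma> w) * cnj (\<mu> w))"
      by (simp add: g_def fun_eq_iff complex_eq_iff)
    \<comment> \<open>As \<open>lam\<close> is real, the conjugate of \<open>\<mu>\<close> is
      \<open>vf_apply L lamc\<close> on all of \<open>U\<close>, so it may be replaced before
      differentiating.\<close>
    moreover have "vf_apply L (\<lambda>w. cnj (\<mu> w)) z = B z"
      unfolding B_def using vf_apply_cong_open[OF open_U z cnj\<mu>] by simp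
    ultimately show ?thesis
      by (simp add: vf_apply_add vf_apply_mult differentiable_mult d A_def H_def H'_def)
  qed
  obtain C1 where C1: "C1 > 0" "\<And>z. z \<in> cball p \<rho> \<Longrightarrow> norm (\<nu> z) \<le> C1"
    using smooth_on_bounded_cball[OF \<nu>(1) \<rho>(2)] by blast
  obtain C2 where C2: "C2 > 0" "\<And>z. z \<in> cball p \<rho> \<Longrightarrow> norm (H z) \<le> C2"
    using smooth_on_bounded_cball[OF sH(1) \<rho>(2)] by blast
  obtain C3 where C3: "C3 > 0" "\<And>z. z \<in> cball p \<rho> \<Longrightarrow> norm (H' z) \<le> C3"
    using smooth_on_bounded_cball[OF sH(2) \<rho>(2)] by blast
  have "cmod (E z + \<nu> z * vf_apply L (\<lambda>w. of_real (g w)) z) \<le> (C1 * (C2 + C3)) * cmod (vf_apply L lamc z)"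
    if z: "z \<in> cball p \<rho>" for z
  proof -
    note zU = in_U[OF z]
    have "E z + \<nu> z * vf_apply L (\<lambda>w. of_real (g w)) z
        = (E z + \<nu> z * (\<gamma> z * A z + cnj (\<gamma> z) * B z)) + \<nu> z * (H z * \<mu> z + H' z * cnj (\<mu> z))"
      unfolding Lg[OF zU] by (simp add: algebra_simps)
    then have "E z + \<nu> z * vf_apply L (\<lambda>w. of_real (g w)) z = \<nu> z * (H z * \<mu> z + H' z * cnj (\<mu> z))"
      unfolding solve[OF zU] by simp
    then have "cmod (E z + \<nu> z * vf_apply L (\<lambda>w. of_real (g w)) z)
        = \<bar>\<nu> z\<bar> * cmod (H z * \<mu> z + H' z * cnj (\<mu> z))" by (simp add: norm_mult)
    also have "\<dots> \<le> C1 * (C2 * cmod (\<mu> z) + C3 * cmod (\<mu> z))"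
    proof (rule mult_mono)
      have "cmod (H z * \<mu> z + H' z * cnj (\<mu> z)) \<le> cmod (H z) * cmod (\<mu> z) + cmod (H' z) * cmod (\<mu> z)"
        by (rule order_trans[OF norm_triangle_ineq]) (simp add: norm_mult)
      also have "\<dots> \<le> C2 * cmod (\<mu> z) + C3 * cmod (\<mu> z)"
        using C2(2)[OF z] C3(2)[OF z] by (intro add_mono mult_right_mono) auto
      finally show "cmod (H z * \<mu> z + H' z * cnj (\<mu> z)) \<le> C2 * cmod (\<mu> z) + C3 * cmod (\<mu> z)" .
    qed (use C1(2)[OF z] C1(1) in auto)
    also have "\<dots> = (C1 * (C2 + C3)) * cmod (cnj (\<mu> z))" by (simp add: algebra_simps)
    finally show ?thesis unfolding cnj\<mu>[OF zU] .
  qed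
  moreover have "C1 * (C2 + C3) > 0" using C1(1) C2(1) C3(1) by simp
  ultimately show ?thesis by (intro that[OF sg])
qed

section \<open>The plurisubharmonic defining function\<close>

lemma (in smooth_boundary_point) lower_bound:
  assumes "smooth_on U f" "\<And>z. z \<in> U \<Longrightarrow> (0::real) < f z"
  obtains m where "m > 0" "\<And>z. z \<in> cball p \<rho> \<Longrightarrow> m \<le> f z"
proof -
  have "smooth_on U (\<lambda>z. inverse (f z))"
    using assms(2) by (intro smooth_intros open_U assms(1)) (metis less_irrefl)
  from smooth_on_bounded_cball[OF this \<rho>(2)] obtain C where C: "C > 0"
    "\<And>z. z \<in> cball p \<rho> \<Longrightarrow> norm (inverse (f z)) \<le> C" by blast
  have "inverse C \<le> f z" if "z \<in> cball p \<rho>" for z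
    using C(2)[OF that] assms(2)[OF in_U[OF that]] C(1) le_imp_inverse_le[of "inverse (f z)" C] by simp
  with C(1) show ?thesis by (intro that[of "inverse C"]) auto
qed

text \<open>At a boundary point every vector is a combination of \<open>L\<close> and the complex
  normal \<open>N\<close>, so the Levi form of the new function is a Hermitian form in the two
  coefficients, to which \<open>hermitian_form_nonneg\<close> applies. The open conditions are
  assumed on all of \<open>U\<close>, for the caller to arrange by shrinking.\<close>

lemma exists_plurisubharmonic_defining_function:
  fixes \<Omega> :: "(complex ^ 2) set" and L :: "complex ^ 2 \<Rightarrow> complex ^ 2"
  assumes sbp: "smooth_boundary_point \<Omega> p U r n \<rho> \<delta> C"
    and L: "tangential_vf \<Omega> r U L" "\<And>z. z \<in> U \<Longrightarrow> L z \<noteq> 0"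
    and nonneg: "\<And>z. z \<in> frontier \<Omega> \<Longrightarrow> z \<in> U \<Longrightarrow> 0 \<le> levi r L z"
    and grad: "\<And>z. z \<in> U \<Longrightarrow> 0 < (\<Sum>j\<in>UNIV. (cmod (dz j (\<lambda>w. complex_of_real (r w)) z))\<^sup>2)"
    and strict: "\<And>z. z \<in> U \<Longrightarrow>
      cmod (vf_apply L (vf_apply L (\<lambda>w. complex_of_real (levi r L w))) z)
        < cmod (vf_apply L (vf_conj_apply L (\<lambda>w. complex_of_real (levi r L w))) z)"
  shows "\<exists>r'. local_defining_function \<Omega> p U r' \<and> plurisubharmonic_on_boundary_near \<Omega> p U r'"
proof -
  interpret smooth_boundary_point \<Omega> p U r n \<rho> \<delta> C by (rule sbp)
  let ?rc = "\<lambda>w. complex_of_real (r w)"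
  let ?lamc = "\<lambda>w. complex_of_real (levi r L w)"
  have sL: "smooth_on U L" and tan: "\<And>z. z \<in> frontier \<Omega> \<Longrightarrow> z \<in> U \<Longrightarrow> vf_apply L ?rc z = 0"
    using L(1) by (auto simp: tangential_vf_def)
  have src: "smooth_on U ?rc" by (intro smooth_intros open_U smooth_r)
  define N :: "complex ^ 2 \<Rightarrow> complex ^ 2" where "N z = (\<chi> j. cnj (dz j ?rc z))" for z
  have sN: "smooth_on U (\<lambda>z. N z $ j)" for j
    unfolding N_def by (simp, intro smooth_intros open_U src)
  have sLj: "smooth_on U (\<lambda>z. L z $ j)" for j by (intro smooth_intros open_U sL)
  define \<nu> where "\<nu> z = Re (\<Sum>j\<in>UNIV. dz j ?rc z * cnj (dz j ?rc z))" for z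
  have s\<nu>: "smooth_on U \<nu>" unfolding \<nu>_def[abs_def] by (intro smooth_intros open_U src)
  have \<nu>_eq: "\<nu> z = (\<Sum>j\<in>UNIV. (cmod (dz j ?rc z))\<^sup>2)" for z
    by (simp add: \<nu>_def complex_mult_cnj cmod_power2)
  have \<nu>pos: "0 < \<nu> z" if "z \<in> U" for z using grad[OF that] by (simp add: \<nu>_eq)
  have Nr: "vf_apply N ?rc z = of_real (\<nu> z)" for z
    unfolding vf_apply_def N_def \<nu>_eq of_real_sum
    by (intro sum.cong refl) (simp only: complex_norm_square vec_lambda_beta mult.commute)
  \<comment> \<open>Since \<open>levi\<close> takes the real part, only the Hermitian part of the Hessian matters, and the symmetry
    of second derivatives is not needed.\<close>
  define E where "E z = (1/2) * (complex_hessian r L N z + cnj (complex_hessian r N L z))" for z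
  have sE: "smooth_on U E"
    unfolding E_def[abs_def] by (intro smooth_intros open_U smooth_r sN sLj)
  have slam: "smooth_on U (levi r L)"
    unfolding levi_def[abs_def] by (intro smooth_intros open_U smooth_r sLj)
  obtain g C1 where sg: "smooth_on U g" and C1: "C1 > 0"
    and F: "\<And>z. z \<in> cball p \<rho> \<Longrightarrow>
      cmod (E z + \<nu> z * vf_apply L (\<lambda>w. of_real (g w)) z) \<le> C1 * cmod (vf_apply L ?lamc z)"
    using exists_correction[OF sL slam sE s\<nu> \<nu>pos strict] by blast
  have sgc: "smooth_on U (\<lambda>w. complex_of_real (g w))" by (intro smooth_intros open_U sg)
  obtain M where M: "M > 0" "\<And>z. z \<in> frontier \<Omega> \<Longrightarrow> z \<in> cball p \<delta> \<Longrightarrow>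
      (cmod (vf_apply L ?lamc z))\<^sup>2 \<le> M * levi r L z"
    using tangential_gradient_estimate[OF slam nonneg[OF _ in_U] L(1)] by blast
  \<comment> \<open>The part of the coefficient of \<open>|b|\<^sup>2\<close> that is free of
    \<open>K\<close>; it must be bounded before \<open>K\<close> can be chosen.\<close>
  define R where "R z = Re (complex_hessian r N N z) + 2 * (\<nu> z * Re (vf_apply N (\<lambda>w. of_real (g w)) z))" for z
  have sR: "smooth_on U R"
  proof -
    have "smooth_on U (\<lambda>z. Re (complex_hessian r N N z) + 2 * (\<nu> z * Re (\<Sum>j\<in>UNIV. N z $ j * dz j (\<lambda>w. complex_of_real (g w)) z)))"
      by (intro smooth_intros open_U smooth_r sN s\<nu> sgc)
    then show ?thesis by (simp add: R_def[abs_def] vf_apply_def)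
  qed
  obtain C2 where C2: "C2 > 0" "\<And>z. z \<in> cball p \<rho> \<Longrightarrow> norm (R z) \<le> C2"
    using smooth_on_bounded_cball[OF sR \<rho>(2)] by blast
  obtain m where m: "m > 0" "\<And>z. z \<in> cball p \<rho> \<Longrightarrow> m \<le> \<nu> z"
    using lower_bound[OF s\<nu> \<nu>pos] by blast
  \<comment> \<open>Chains the two estimates: \<open>|F|\<^sup>2 \<le> C1\<^sup>2 |L
    \<lambda>|\<^sup>2 \<le> C1\<^sup>2 M \<lambda>\<close>.\<close>
  define c where "c = C1\<^sup>2 * M"
  have c: "c > 0" using C1 M(1) by (simp add: c_def)
  \<comment> \<open>With \<open>m \<le> \<nu> z\<close> this gives
    \<open>C2 + c \<le> K * (\<nu> z)\<^sup>2\<close>, enough to beat the bound \<open>C2\<close> on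
    \<open>R\<close> and leave at least \<open>c\<close>.\<close>
  define K where "K = (C2 + c) / m\<^sup>2"
  have K: "K \<ge> 0" "K * m\<^sup>2 = C2 + c" using C2(1) c m(1) by (auto simp: K_def)
  define G where "G z = g z + K * r z" for z
  have sG: "smooth_on U G" unfolding G_def[abs_def] by (intro smooth_intros open_U sg smooth_r)
  define r' where "r' z = r z * exp (G z)" for z
  have "local_defining_function \<Omega> p U r'"
    unfolding r'_def[abs_def] by (intro local_defining_function_mult open_domain ldf smooth_intros open_U sG) simp
  moreover have "0 \<le> levi r' V z" if z: "z \<in> frontier \<Omega>" "z \<in> ball p \<delta>" for V z
  proof -
    have z\<delta>: "z \<in> cball p \<delta>" and z\<rho>: "z \<in> cball p \<rho>" using z(2) \<delta>(2) by auto
    note zU = in_U[OF z\<rho>]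
    have r0: "r z = 0" by (rule r_zero[OF z(1) z\<rho>])
    define ra where "ra = (\<chi> j. dz j ?rc z)"
    have "ra \<noteq> 0"
    proof
      assume "ra = 0"
      then have "dz j ?rc z = 0" for j by (simp add: ra_def vec_eq_iff)
      then show False using grad[OF zU] by simp
    qed
    moreover have "L z $ 1 * ra $ 1 + L z $ 2 * ra $ 2 = 0"
      using tan[OF z(1) zU] by (simp add: vf_apply_def sum_2 ra_def)
    ultimately obtain a b where "V z = a *s L z + b *s (\<chi> j. cnj (ra $ j))"
      using complex_2_decomposition[OF L(2)[OF zU]] by blast
    then have V: "V z = a *s L z + b *s N z" by (simp add: N_def ra_def)
    have Gd: "vf_apply A (\<lambda>w. of_real (G w)) z
        = vf_apply A (\<lambda>w. of_real (g w)) z + of_real K * vf_apply A ?rc z" for A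
    proof -
      have d: "(\<lambda>w. complex_of_real (g w)) differentiable (at z)" "?rc differentiable (at z)"
        using smooth_on_differentiable[OF sgc zU] smooth_on_differentiable[OF src zU] by auto
      have "(\<lambda>w. complex_of_real (G w)) = (\<lambda>w. of_real (g w) + of_real K * ?rc w)"
        by (simp add: G_def fun_eq_iff)
      then show ?thesis by (simp add: vf_apply_add vf_apply_mult differentiable_mult d)
    qed
    let ?x = "vf_apply L (\<lambda>w. of_real (g w)) z" and ?y = "vf_apply N (\<lambda>w. of_real (g w)) z"
    \<comment> \<open>Only the normal component of \<open>V\<close> differentiates \<open>r\<close>;
      hence \<open>K\<close> enters the Levi form solely through \<open>|b|\<^sup>2\<close>.\<close>
    have Vr: "vf_apply V ?rc z = b * of_real (\<nu> z)"
      by (simp add: vf_apply_combination[of V z a L b N, OF V] tan[OF z(1) zU] Nr)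
    have VG: "vf_apply V (\<lambda>w. of_real (G w)) z = a * ?x + b * (?y + of_real (K * \<nu> z))"
      by (simp add: vf_apply_combination[of V z a L b N, OF V] Gd tan[OF z(1) zU] Nr distrib_left mult_ac)
    have aa: "w * cnj w = of_real ((cmod w)\<^sup>2)" for w by (simp only: complex_norm_square)
    have lev: "levi r V z = (cmod a)\<^sup>2 * levi r L z + 2 * Re (a * cnj b * E z)
        + (cmod b)\<^sup>2 * Re (complex_hessian r N N z)"
      unfolding levi_def complex_hessian_combination[of V z a L b N, OF V] aa
      by (simp add: E_def field_simps)
    have cross: "Re (vf_apply V (\<lambda>w. of_real (G w)) z * cnj (vf_apply V ?rc z))
      = Re (a * cnj b * (of_real (\<nu> z) * ?x)) + (cmod b)\<^sup>2 * (\<nu> z * Re ?y + K * (\<nu> z)\<^sup>2)"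
    proof -
      have "vf_apply V (\<lambda>w. of_real (G w)) z * cnj (vf_apply V ?rc z)
        = a * cnj b * (of_real (\<nu> z) * ?x) + (b * cnj b) * (of_real (\<nu> z) * ?y + of_real (K * (\<nu> z)\<^sup>2))"
        unfolding Vr VG by (simp add: algebra_simps power2_eq_square)
      then show ?thesis unfolding aa by simp
    qed
    have "levi r' V z = exp (G z) * ((cmod a)\<^sup>2 * levi r L z
        + 2 * Re (a * cnj b * (E z + of_real (\<nu> z) * ?x)) + (cmod b)\<^sup>2 * (R z + 2 * K * (\<nu> z)\<^sup>2))"
      unfolding r'_def[abs_def] levi_mult_exp[OF open_U zU smooth_r sG r0] lev cross
      by (simp add: R_def algebra_simps)
    moreover have "0 \<le> (cmod a)\<^sup>2 * levi r L z
        + 2 * Re (a * cnj b * (E z + of_real (\<nu> z) * ?x)) + (cmod b)\<^sup>2 * (R z + 2 * K * (\<nu> z)\<^sup>2)"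
    proof (rule hermitian_form_nonneg[OF c])
      have "(cmod (E z + of_real (\<nu> z) * ?x))\<^sup>2 \<le> (C1 * cmod (vf_apply L ?lamc z))\<^sup>2"
        using F[OF z\<rho>] by (intro power_mono) auto
      also have "\<dots> \<le> C1\<^sup>2 * (M * levi r L z)"
        unfolding power_mult_distrib by (intro mult_left_mono M(2) z(1) z\<delta>) auto
      finally show "(cmod (E z + of_real (\<nu> z) * ?x))\<^sup>2 \<le> c * levi r L z"
        by (simp add: c_def mult.assoc)
      have "K * m\<^sup>2 \<le> K * (\<nu> z)\<^sup>2"
        using m(1) m(2)[OF z\<rho>] K(1) by (intro mult_left_mono power_mono) auto
      then have "C2 + c \<le> K * (\<nu> z)\<^sup>2" using K(2) by simp
      moreover have "- C2 \<le> R z" using C2(2)[OF z\<rho>] by (simp add: abs_le_iff)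
      ultimately show "c \<le> R z + 2 * K * (\<nu> z)\<^sup>2" using C2(1) c by linarith
    qed
    ultimately show ?thesis by simp
  qed
  then have "plurisubharmonic_on_boundary_near \<Omega> p U r'"
    unfolding plurisubharmonic_on_boundary_near_def
    using \<delta>(1) ball_subset_U by (intro exI[of _ "ball p \<delta>"]) auto
  ultimately show ?thesis by blast
qed

theorem theorem5p1:
  fixes \<Omega> :: "(complex ^ 2) set" and p0 :: "complex ^ 2"
  assumes "open \<Omega>" and "connected \<Omega>"
    and "smooth_boundary \<Omega>"
    and "pseudoconvex \<Omega>"
    and "p0 \<in> frontier \<Omega>" and "weakly_pseudoconvex_at \<Omega> p0"
    and "strict_type_4 \<Omega> p0"
  shows "\<exists>U r. local_defining_function \<Omega> p0 U r \<and> plurisubharmonic_on_boundary_near \<Omega> p0 U r"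
proof -
  obtain U r L where ldf: "local_defining_function \<Omega> p0 U r" and L: "tangential_vf \<Omega> r U L"
    and L0: "\<forall>z \<in> U. L z \<noteq> 0"
    and st: "let lam = (\<lambda>z. complex_of_real (levi r L z)) in
          Re (vf_apply L (vf_conj_apply L lam) p0) > cmod (vf_apply L (vf_apply L lam) p0)"
    using assms(7) unfolding strict_type_4_def by (elim conjE exE)
  let ?rc = "\<lambda>w. complex_of_real (r w)"
  let ?lamc = "\<lambda>w. complex_of_real (levi r L w)"
  let ?A = "vf_apply L (vf_conj_apply L ?lamc)" and ?B = "vf_apply L (vf_apply L ?lamc)"
  let ?\<nu> = "\<lambda>z. \<Sum>j\<in>UNIV. (cmod (dz j ?rc z))\<^sup>2"
  have U: "open U" "p0 \<in> U" and sr: "smooth_on U r" and sL: "smooth_on U L"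
    using ldf L by (auto simp: local_defining_function_def tangential_vf_def)
  have slam: "smooth_on U ?lamc"
    unfolding levi_def[abs_def] by (intro smooth_intros U sr sL)
  have cont: "continuous_on U (dz j ?rc)" "continuous_on U ?A" "continuous_on U ?B" for j
    by (rule smooth_on_continuous, intro smooth_intros U sr sL slam)+
  \<comment> \<open>Passing from the real part to the modulus keeps a strict inequality between
    continuous functions, which persists near \<open>p0\<close>.\<close>
  have strict0: "cmod (?B p0) < cmod (?A p0)"
    using st complex_Re_le_cmod[of "?A p0"] by (simp add: Let_def)
  \<comment> \<open>If all \<open>dz j ?rc p0\<close> vanished, applying constant fields
    \<open>v\<close> to \<open>r\<close> would show that its real derivative vanishes at
    \<open>p0\<close>.\<close>
  have grad0: "0 < ?\<nu> p0"
  proof (rule ccontr)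
    assume "\<not> 0 < ?\<nu> p0"
    then have "?\<nu> p0 = 0" using sum_nonneg[of UNIV "\<lambda>j. (cmod (dz j ?rc p0))\<^sup>2"] by (simp add: not_less)
    then have z: "dz j ?rc p0 = 0" for j by (simp add: sum_nonneg_eq_0_iff)
    have "frechet_derivative r (at p0) v = 0" for v
    proof -
      have d: "?rc differentiable (at p0)"
        by (rule smooth_on_differentiable[OF smooth_on_of_real[OF U(1) sr] U(2)])
      have "vf_apply (\<lambda>_. v) ?rc p0 = 0" by (simp add: vf_apply_def z)
      then show ?thesis
        using vf_apply_frechet(1)[OF d, of "\<lambda>_. v"]
        by (simp add: frechet_of_real[OF smooth_on_differentiable[OF sr U(2)]] complex_eq_iff)
    qed
    then have "frechet_derivative r (at p0) = (\<lambda>v. 0)" by (rule ext)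
    then show False using ldf assms(5) U(2) by (auto simp: local_defining_function_def)
  qed
  obtain W where W: "open W" "p0 \<in> W" "W \<subseteq> U"
    "\<And>z. z \<in> frontier \<Omega> \<Longrightarrow> z \<in> W \<Longrightarrow> 0 \<le> levi r L z"
    using levi_nonneg_of_pseudoconvex_at[OF assms(1) ldf L] assms(4,5)
    unfolding pseudoconvex_def by blast
  \<comment> \<open>Shrinks to an open set on which the sign of the Levi form, the strict inequality
    and the nonzero gradient hold simultaneously.\<close>
  define W' where "W' = W \<inter> (U \<inter> (\<lambda>z. cmod (?A z) - cmod (?B z)) -` {0<..}) \<inter> (U \<inter> ?\<nu> -` {0<..})"
  have "p0 \<in> W'" using strict0 grad0 U(2) W(2) by (simp add: W'_def)
  have "open W'" unfolding W'_def
    by (intro open_Int W(1) continuous_open_preimage U(1) open_greaterThan continuous_intros cont)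
  have W'U: "W' \<subseteq> U" by (auto simp: W'_def)
  have ldf': "local_defining_function \<Omega> p0 W' r"
    by (rule local_defining_function_subset[OF ldf \<open>open W'\<close> \<open>p0 \<in> W'\<close> W'U])
  have L': "tangential_vf \<Omega> r W' L"
    using L smooth_on_subset[OF sL W'U] W'U by (auto simp: tangential_vf_def)
  obtain n \<rho> \<delta> C where "smooth_boundary_point \<Omega> p0 W' r n \<rho> \<delta> C"
    using smooth_boundary_point_exists[OF assms(1) ldf' assms(5)] by blast
  then have "\<exists>r'. local_defining_function \<Omega> p0 W' r' \<and> plurisubharmonic_on_boundary_near \<Omega> p0 W' r'"
    by (rule exists_plurisubharmonic_defining_function[OF _ L'])
      (use L0 W(4) W'U in \<open>auto simp: W'_def\<close>)
  then show ?thesis by blast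
qed

end
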